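(* Let $N(m,n)$ denote the number of maximum independent sets (distance-$2$ MDS codes) in the Doob graph $D(m,n)$. Then $$N(m,n)=2^{2^{2m+n-1}(1+o(1))}\qquad\text{as } 2m+n\to\infty,$$ i.e. $\log_2 N(m,n) = 2^{2m+n-1}(1+o(1))$ as $2m+n\to\infty$.
   Context: The Shrikhande graph $\mathrm{Sh}$ is the graph with vertex set $\mathbb{Z}_4^2$ in which $u$ and $v$ are adjacent iff $u-v\in\{\pm(1,0),\pm(0,1),\pm(1,1)\}$. $K_4$ is the complete graph on $4$ vertices. For integers $m,n\ge 0$, $D(m,n)$ is the Cartesian product of $m$ copies of $\mathrm{Sh}$ and $n$ copies of $K_4$ (for $m=0$ this is the Hamming graph $H(n,4)$). The independence number of $D(m,n)$ is $4^{2m+n-1}$, and a maximum independent set in $D(m,n)$ (an independent set of size $4^{2m+n-1}$) is called an MDS code. *)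

theory Defs
  imports
    Complex_Main
    "Graph_Theory.Pair_Digraph"
    "HOL-Library.FuncSet"
    "HOL-Library.Landau_Symbols"
    "HOL-Library.Numeral_Type"
    "HOL-Library.Product_Plus"
begin

text \<open>
  Finite simple graphs are elements of \<open>'a pair_pre_digraph\<close> satisfying \<open>pair_graph\<close>:
  an undirected edge is a pair of opposite arcs.  The ring \<open>\<int>\<^sub>4\<close> is the numeral type \<open>4\<close>.
\<close>

definition shrikhande :: "(4 \<times> 4) pair_pre_digraph" where
  "shrikhande = \<lparr> pverts = UNIV,
     parcs = {(u, v). u - v \<in> {(1, 0), - (1, 0), (0, 1), - (0, 1), (1, 1), - (1, 1)}} \<rparr>"

definition K4 :: "4 pair_pre_digraph" where
  "K4 = \<lparr> pverts = UNIV, parcs = {(u, v). u \<noteq> v} \<rparr>"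

definition cart_prod :: "'a pair_pre_digraph \<Rightarrow> 'b pair_pre_digraph \<Rightarrow> ('a \<times> 'b) pair_pre_digraph"
  where
  "cart_prod G H = \<lparr> pverts = pverts G \<times> pverts H,
     parcs = {((a, b), (a', b')).
       (a, a') \<in> parcs G \<and> b = b' \<and> b \<in> pverts H \<or>
       a = a' \<and> a \<in> pverts G \<and> (b, b') \<in> parcs H} \<rparr>"

text \<open>
  For \<open>k = 0\<close> this is the graph with one vertex and no edges, the unit of \<open>cart_prod\<close>.
\<close>

definition cart_power :: "'a pair_pre_digraph \<Rightarrow> nat \<Rightarrow> (nat \<Rightarrow> 'a) pair_pre_digraph" where
  "cart_power G k = \<lparr> pverts = {..<k} \<rightarrow>\<^sub>E pverts G,
     parcs = {(x, y). x \<in> {..<k} \<rightarrow>\<^sub>E pverts G \<and> y \<in> {..<k} \<rightarrow>\<^sub>E pverts G \<and>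
       (\<exists>i<k. (x i, y i) \<in> parcs G \<and> (\<forall>j<k. j \<noteq> i \<longrightarrow> x j = y j))} \<rparr>"

definition doob :: "nat \<Rightarrow> nat \<Rightarrow> ((nat \<Rightarrow> 4 \<times> 4) \<times> (nat \<Rightarrow> 4)) pair_pre_digraph" where
  "doob m n = cart_prod (cart_power shrikhande m) (cart_power K4 n)"

definition independent_set :: "'a pair_pre_digraph \<Rightarrow> 'a set \<Rightarrow> bool" where
  "independent_set G S \<longleftrightarrow> S \<subseteq> pverts G \<and> (\<forall>u\<in>S. \<forall>v\<in>S. (u, v) \<notin> parcs G)"

definition maximum_independent_set :: "'a pair_pre_digraph \<Rightarrow> 'a set \<Rightarrow> bool" where
  "maximum_independent_set G S \<longleftrightarrow>
     independent_set G S \<and> (\<forall>T. independent_set G T \<longrightarrow> card T \<le> card S)"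

definition num_mds :: "nat \<Rightarrow> nat \<Rightarrow> nat" where
  "num_mds m n = card {S. maximum_independent_set (doob m n) S}"

lemma pair_graph_iff:
  "pair_graph G \<longleftrightarrow> finite (pverts G) \<and> parcs G \<subseteq> pverts G \<times> pverts G \<and>
     sym (parcs G) \<and> irrefl (parcs G)" (is "?L \<longleftrightarrow> ?R")
proof
  assume ?L
  then interpret pair_graph G .
  show ?R
    using pair_finite_verts arc_fst_in_verts arc_snd_in_verts pair_sym_arcs pair_no_loops
    by (fastforce simp: sym_def irrefl_def symmetric_def)
next
  assume R: ?R
  then have "finite (parcs G)"
    by (meson finite_SigmaI finite_subset)
  with R show ?L
    by unfold_locales (auto simp: sym_def irrefl_def symmetric_def)
qed

lemma pair_graph_shrikhande: "pair_graph shrikhande"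
proof -
  have neg: "- d \<in> {(1, 0), - (1, 0), (0, 1), - (0, 1), (1, 1), - (1, 1)}"
    if "d \<in> {(1, 0), - (1, 0), (0, 1), - (0, 1), (1, 1), - (1, 1)}" for d :: "4 \<times> 4"
    using that by auto
  have "sym (parcs shrikhande)"
  proof (rule symI)
    fix u v
    assume "(u, v) \<in> parcs shrikhande"
    then show "(v, u) \<in> parcs shrikhande"
      using neg[of "u - v"] unfolding shrikhande_def minus_diff_eq by simp
  qed
  then show ?thesis
    by (auto simp: pair_graph_iff shrikhande_def irrefl_def zero_prod_def)
qed

lemma pair_graph_K4: "pair_graph K4"
  by (auto simp: pair_graph_iff K4_def irrefl_def sym_def)

lemma pair_graph_cart_prod:
  "pair_graph G \<Longrightarrow> pair_graph H \<Longrightarrow> pair_graph (cart_prod G H)"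
  by (auto simp: pair_graph_iff cart_prod_def irrefl_def sym_def)

lemma pair_graph_cart_power: "pair_graph G \<Longrightarrow> pair_graph (cart_power G k)"
  by (auto simp: pair_graph_iff cart_power_def irrefl_def sym_def intro!: finite_PiE)

lemma pair_graph_doob: "pair_graph (doob m n)"
  by (simp add: doob_def pair_graph_cart_prod pair_graph_cart_power
      pair_graph_shrikhande pair_graph_K4)

end

theory Submission
  imports Defs "HOL-Library.Code_Cardinality"
begin

text \<open>
  Lower bound: label the vertices of \<open>K\<^sub>4\<close> by pairs of bits, and a vertex \<open>(i, j)\<close> of the Shrikhande graph
  by the bits \<open>i mod 2\<close> and \<open>j mod 2\<close>.  The vertices whose first bits sum to zero and whose second bits
  sum to an arbitrary function of the first bits (of \<open>i\<close> itself for a Shrikhande factor) form a code,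
  and this function has \<open>2 ^ (2 m + n - 1)\<close> arguments.

  Upper bound: the sixteen independent 4-sets of the Shrikhande graph can be mapped injectively to
  permutations of four symbols so that disjoint sets go to disjoint permutation graphs.  Applying this map
  fibrewise turns a code in \<open>D(m, n)\<close> into a code in \<open>D(m - 1, n + 2)\<close>, hence \<open>N(m, n) \<le> N(0, 2 m + n)\<close>, and
  the latter number counts the Latin hypercubes of order 4 and dimension \<open>k = 2 m + n - 1\<close>.

  A Latin hypercube is built up along the subsets \<open>S\<close> of the coordinates: once it is known at the
  points with support properly contained in \<open>S\<close> (the boundary), the values at the points with support
  \<open>S\<close> are to be chosen.  The key fact is that three different choices exist only if the boundary is affine
  over the Klein four-group, and in that case there are at most four choices, exactly one of them affine.
  So along a chain of subsets the choice is forced as long as it is affine, it is one of at most three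
  when it first fails to be affine, and one of at most two afterwards.  A chain of length \<open>l\<close> thus
  contributes a factor of at most \<open>3 * 2 ^ l\<close>, and the \<open>2 ^ k\<close> subsets can be partitioned into
  \<open>o(2 ^ k)\<close> chains.
\<close>

section \<open>The Klein four-group\<close>

typedef klein = "UNIV :: (2 \<times> 2) set" ..

setup_lifting type_definition_klein

instantiation klein :: ab_group_add
begin

lift_definition zero_klein :: klein is 0 .
lift_definition plus_klein :: "klein \<Rightarrow> klein \<Rightarrow> klein" is "(+)" .
lift_definition uminus_klein :: "klein \<Rightarrow> klein" is uminus .
lift_definition minus_klein :: "klein \<Rightarrow> klein \<Rightarrow> klein" is "(-)" .

instance
  by standard (transfer; simp)+

end

instance klein :: finite
  by standard (simp add: type_definition.univ[OF type_definition_klein])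

lemma card_UNIV_klein [simp]: "card (UNIV :: klein set) = 4"
  by (simp add: type_definition.card[OF type_definition_klein])

lemma klein_add_self [simp]: "x + x = (0 :: klein)"
proof -
  have "\<forall>b :: 2. b + b = 0" by code_simp
  then show ?thesis by transfer (simp add: prod_eq_iff)
qed

lemma klein_add_self_left [simp]: "x + (x + y) = (y :: klein)"
  by (simp flip: add.assoc)

lemma klein_add_eq_iff: "x + y = z \<longleftrightarrow> x = z + (y :: klein)"
  by (metis add.assoc add.right_neutral klein_add_self)

lemma klein_add_eq_0_iff [simp]: "x + y = 0 \<longleftrightarrow> x = (y :: klein)"
  by (simp add: klein_add_eq_iff)

lemma klein_cases:
  fixes a b x :: klein
  assumes "a \<noteq> 0" "b \<noteq> 0" "a \<noteq> b"
  shows "x = 0 \<or> x = a \<or> x = b \<or> x = a + b"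
proof -
  have "card {0, a, b, a + b} = card (UNIV :: klein set)" using assms by auto
  then have "{0, a, b, a + b} = UNIV" by (intro card_subset_eq) auto
  then show ?thesis by auto
qed

lemma klein_fourth_unique:
  fixes c c' :: klein
  assumes "distinct [u, v, w]" "c \<notin> {u, v, w}" "c' \<notin> {u, v, w}"
  shows "c = c'"
proof (rule ccontr)
  assume "c \<noteq> c'"
  then have "card {c, c', u, v, w} = 5" using assms by auto
  then show False using card_mono[of "UNIV :: klein set" "{c, c', u, v, w}"] by simp
qed

section \<open>Latin hypercubes\<close>

definition points :: "'i set \<Rightarrow> ('i \<Rightarrow> 'v :: zero) set" where
  "points S = {x. \<forall>i. i \<notin> S \<longrightarrow> x i = 0}"

definition boundary :: "'i set \<Rightarrow> ('i \<Rightarrow> 'v :: zero) set" where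
  "boundary S = {x \<in> points S. \<exists>i\<in>S. x i = 0}"

definition latin :: "'i set \<Rightarrow> (('i \<Rightarrow> 'v :: zero) \<Rightarrow> 'w) \<Rightarrow> bool" where
  "latin S f \<longleftrightarrow> (\<forall>x\<in>points S. \<forall>i\<in>S. inj (\<lambda>v. f (x(i := v))))"

lemma points_upd: "x \<in> points S \<Longrightarrow> i \<in> S \<Longrightarrow> x(i := v) \<in> points S"
  by (auto simp: points_def)

lemma points_insert_upd: "x \<in> points S \<Longrightarrow> x(i := v) \<in> points (insert i S)"
  by (auto simp: points_def)

lemma points_remove_upd: "x \<in> points (insert i S) \<Longrightarrow> x(i := 0) \<in> points S"
  by (auto simp: points_def)

lemma points_mono: "S \<subseteq> T \<Longrightarrow> points S \<subseteq> points T"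
  by (auto simp: points_def)

lemma points_upd_0: "x \<in> points S \<Longrightarrow> i \<notin> S \<Longrightarrow> x(i := 0) = x"
  by (auto simp: points_def)

lemma zero_mem_points: "(\<lambda>_. 0) \<in> points S"
  by (simp add: points_def)

lemma boundary_subset: "boundary S \<subseteq> points S"
  by (auto simp: boundary_def)

lemma finite_points:
  assumes "finite S"
  shows "finite (points S :: ('i \<Rightarrow> 'v :: {zero, finite}) set)"
proof -
  have "inj_on (\<lambda>x. restrict x S) (points S :: ('i \<Rightarrow> 'v) set)"
  proof (intro inj_onI ext)
    fix x y :: "'i \<Rightarrow> 'v" and i assume "x \<in> points S" "y \<in> points S" "restrict x S = restrict y S"
    then show "x i = y i" by (cases "i \<in> S") (auto simp: points_def dest: fun_cong[of _ _ i])
  qed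
  moreover have "(\<lambda>x. restrict x S) ` points S \<subseteq> S \<rightarrow>\<^sub>E (UNIV :: 'v set)" by auto
  ultimately show ?thesis using assms by (meson finite_PiE finite inj_on_finite)
qed

lemma latin_neq:
  assumes "latin S f" "x \<in> points S" "i \<in> S" "v \<noteq> w"
  shows "f (x(i := v)) \<noteq> f (x(i := w))"
  using assms unfolding latin_def inj_def by blast

lemma latin_neq_upd:
  assumes "latin S f" "x \<in> points S" "i \<in> S" "x i \<noteq> w"
  shows "f x \<noteq> f (x(i := w))"
  using latin_neq[OF assms] by simp

lemma latin_mono:
  assumes "latin S f" "T \<subseteq> S"
  shows "latin T f"
  using assms points_mono[OF assms(2)] unfolding latin_def by blast

lemma latin_slice:
  assumes "latin (insert r T) f" "r \<notin> T"
  shows "latin T (\<lambda>x. f (x(r := c)))"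
  unfolding latin_def
proof (intro ballI injI)
  fix x i v w assume x_in: "x \<in> points T" and i_in: "i \<in> T"
    and values_eq: "f (x(i := v, r := c)) = f (x(i := w, r := c))"
  have "x(i := u, r := c) = x(r := c, i := u)" for u
    by (rule fun_upd_twist) (use i_in assms(2) in auto)
  then show "v = w"
    using latin_neq[OF assms(1) points_insert_upd[OF x_in], of i v w c] i_in values_eq by auto
qed

lemma points_change_induct [consumes 3, case_names start step]:
  assumes "finite S" "x \<in> points S" "y \<in> points S"
    and "P x"
    and "\<And>z i. z \<in> points S \<Longrightarrow> (\<And>j. z j \<in> {x j, y j}) \<Longrightarrow> i \<in> S \<Longrightarrow> P z \<Longrightarrow> P (z(i := y i))"
  shows "P y"
proof -
  have "P (\<lambda>i. if i \<in> T then y i else x i)" if "finite T" "T \<subseteq> S" for T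
    using that
  proof (induction T)
    case empty
    then show ?case using assms(4) by simp
  next
    case (insert i T)
    let ?z = "\<lambda>i. if i \<in> T then y i else x i"
    have "?z \<in> points S" using assms(2,3) by (auto simp: points_def)
    then have "P (?z(i := y i))" using insert by (intro assms(5)) auto
    moreover have "?z(i := y i) = (\<lambda>j. if j \<in> insert i T then y j else x j)" by auto
    ultimately show ?case by simp
  qed
  then have "P (\<lambda>i. if i \<in> S then y i else x i)" using assms(1) by simp
  moreover have "(\<lambda>i. if i \<in> S then y i else x i) = y"
    using assms(2,3) by (auto simp: points_def)
  ultimately show ?thesis by simp
qed

section \<open>Extending the sum function\<close>

definition deviation :: "'i set \<Rightarrow> (('i \<Rightarrow> klein) \<Rightarrow> klein) \<Rightarrow> ('i \<Rightarrow> klein) \<Rightarrow> klein" where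
  "deviation S f x = f x + sum x S"

definition flip_box :: "'i set \<Rightarrow> klein \<Rightarrow> ('i \<Rightarrow> klein) \<Rightarrow> bool" where
  "flip_box S e x \<longleftrightarrow> (\<forall>i\<in>S. x i \<noteq> 0 \<and> x i \<noteq> e)"

definition flip :: "'i set \<Rightarrow> klein \<Rightarrow> ('i \<Rightarrow> klein) \<Rightarrow> klein" where
  "flip S e x = (if flip_box S e x then e else 0)"

lemma eq_sum_plus_deviation: "f x = sum x S + deviation S f x"
  by (simp add: deviation_def ac_simps)

lemma sum_upd:
  fixes x :: "'i \<Rightarrow> klein"
  assumes "finite S" "i \<in> S"
  shows "sum (x(i := v)) S = sum x S + x i + v"
proof -
  have "sum (x(i := v)) S = v + sum x (S - {i})"
    using assms by (subst sum.remove[of _ i]) (auto intro!: arg_cong2[of _ _ _ _ "(+)"] sum.cong)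
  moreover have "sum x S = x i + sum x (S - {i})"
    using assms by (rule sum.remove)
  ultimately show ?thesis by (simp add: ac_simps)
qed

lemma sum_upd_notin: "i \<notin> S \<Longrightarrow> sum (x(i := v)) S = sum x S"
  by (intro sum.cong) auto

lemma latin_deviation_neq:
  assumes "finite S" "latin S f" "x \<in> points S" "i \<in> S" "v \<noteq> w"
  shows "v + deviation S f (x(i := v)) \<noteq> w + deviation S f (x(i := w))"
  using latin_neq[OF assms(2-5)] sum_upd[OF assms(1,4), of x]
  by (auto simp: eq_sum_plus_deviation[of f _ S] add.assoc)

lemma latin_deviation_neq_upd:
  assumes "finite S" "latin S f" "x \<in> points S" "i \<in> S" "x i \<noteq> w"
  shows "x i + deviation S f x \<noteq> w + deviation S f (x(i := w))"
  using latin_deviation_neq[OF assms] by simp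

locale latin_sum_boundary =
  fixes S :: "'i set" and f :: "('i \<Rightarrow> klein) \<Rightarrow> klein"
  assumes finite: "finite S" and card_ge_2: "card S \<ge> 2" and latin: "latin S f"
    and boundary_eq_sum: "x \<in> boundary S \<Longrightarrow> f x = sum x S"
begin

abbreviation "\<delta> \<equiv> deviation S f"

lemma deviation_neq_coordinate:
  assumes "x \<in> points S" "i \<in> S" "x i \<noteq> 0"
  shows "\<delta> x \<noteq> x i"
proof -
  have "x(i := 0) \<in> boundary S" using assms by (auto simp: boundary_def points_def)
  then have "\<delta> (x(i := 0)) = 0" by (simp add: deviation_def boundary_eq_sum)
  then show ?thesis
    using latin_deviation_neq_upd[OF finite latin assms] by (auto simp: add.commute)
qed

lemma flip_box_deviation:
  assumes "x \<in> points S" "\<delta> x \<noteq> 0"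
  shows "flip_box S (\<delta> x) x"
  unfolding flip_box_def
proof (intro ballI conjI)
  fix i assume i_in: "i \<in> S"
  show nonzero: "x i \<noteq> 0"
    using assms i_in boundary_eq_sum[of x] by (auto simp: boundary_def deviation_def)
  show "x i \<noteq> \<delta> x" using deviation_neq_coordinate[OF assms(1) i_in nonzero] by (rule not_sym)
qed

lemma deviation_upd_in_flip_box:
  assumes x_in: "x \<in> points S" "flip_box S e x" "\<delta> x = e" and "e \<noteq> 0" and i_in: "i \<in> S"
    and q_neq: "q \<noteq> 0" "q \<noteq> e"
  shows "\<delta> (x(i := q)) = e"
proof (cases "q = x i")
  case True
  then show ?thesis using x_in(3) by simp
next
  case False
  obtain j where j_in: "j \<in> S" "j \<noteq> i"
    using card_ge_2 by (metis One_nat_def Suc_1 card_le_Suc0_iff_eq finite not_less_eq_eq)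
  let ?p = "x i" and ?y = "x j"
  have p_neq: "?p \<noteq> 0" "?p \<noteq> e" and y_neq: "?y \<noteq> 0" "?y \<noteq> e" using x_in(2) i_in j_in
    by (auto simp: flip_box_def)
  have q_eq: "q = e + ?p" using klein_cases[of e ?p q] \<open>e \<noteq> 0\<close> p_neq q_neq False by auto
  have upd_in: "x(i := v) \<in> points S" for v using x_in(1) i_in by (rule points_upd)
  have not_y: "\<delta> (x(i := v)) \<noteq> ?y" for v
    using deviation_neq_coordinate[OF upd_in j_in(1), of v] j_in(2) y_neq by simp
  have not_v: "\<delta> (x(i := v)) \<noteq> v" if "v \<noteq> 0" for v
    using deviation_neq_coordinate[OF upd_in i_in, of v] that by simp
  have line_e: "?p + e \<noteq> e + \<delta> (x(i := e))" and line_q: "?p + e \<noteq> q + \<delta> (x(i := q))"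
    and line_qe: "q + \<delta> (x(i := q)) \<noteq> e + \<delta> (x(i := e))"
    using latin_deviation_neq_upd[OF finite latin x_in(1) i_in, of e]
      latin_deviation_neq_upd[OF finite latin x_in(1) i_in, of q]
      latin_deviation_neq[OF finite latin x_in(1) i_in, of q e] p_neq q_neq False x_in(3) by auto
  show ?thesis
  proof (rule ccontr)
    assume "\<delta> (x(i := q)) \<noteq> e"
    then have "\<delta> (x(i := q)) = ?p"
      using klein_cases[of e ?p "\<delta> (x(i := q))"] \<open>e \<noteq> 0\<close> p_neq not_v[OF q_neq(1)] line_q q_eq
      by (auto simp: add.commute)
    moreover from this have "?y = q"
      using klein_cases[of e ?p ?y] \<open>e \<noteq> 0\<close> p_neq y_neq not_y[of q] q_eq by auto
    ultimately show False
      using klein_cases[of e ?p "\<delta> (x(i := e))"] \<open>e \<noteq> 0\<close> p_neq not_v[of e] not_y[of e] line_e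
        line_qe q_eq
      by (auto simp: add.commute add.left_commute)
  qed
qed

lemma deviation_eq_on_flip_box:
  assumes x_in: "x \<in> points S" "\<delta> x \<noteq> 0" and y_in: "y \<in> points S" "flip_box S (\<delta> x) y"
  shows "\<delta> y = \<delta> x"
  using finite x_in(1) y_in(1)
proof (induction rule: points_change_induct)
  case start
  show ?case by simp
next
  case (step z i)
  have "flip_box S (\<delta> x) z"
    unfolding flip_box_def
  proof
    fix j assume "j \<in> S"
    with step(2)[of j] flip_box_deviation[OF x_in] y_in(2) show "z j \<noteq> 0 \<and> z j \<noteq> \<delta> x"
      by (auto simp: flip_box_def)
  qed
  moreover have "y i \<noteq> 0" "y i \<noteq> \<delta> x" using y_in(2) step(3) by (auto simp: flip_box_def)
  ultimately show ?case using deviation_upd_in_flip_box[OF step(1) _ step(4) x_in(2) step(3)] by blast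
qed

lemma nonzero_deviation_unique:
  assumes x_in: "x \<in> points S" "\<delta> x \<noteq> 0" and y_in: "y \<in> points S" "\<delta> y \<noteq> 0"
  shows "\<delta> y = \<delta> x"
proof (rule ccontr)
  assume deviations_neq: "\<delta> y \<noteq> \<delta> x"
  define z where "z i = (if i \<in> S then \<delta> x + \<delta> y else 0)" for i
  have z_in: "z \<in> points S" by (simp add: z_def points_def)
  have "flip_box S (\<delta> x) z" "flip_box S (\<delta> y) z"
    using deviations_neq x_in(2) y_in(2) by (auto simp: flip_box_def z_def)
  then show False
    using deviation_eq_on_flip_box[OF x_in z_in] deviation_eq_on_flip_box[OF y_in z_in]
      deviations_neq by simp
qed

lemma ex_deviation_eq_flip: "\<exists>e. \<forall>x\<in>points S. \<delta> x = flip S e x"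
proof (cases "\<exists>x\<in>points S. \<delta> x \<noteq> 0")
  case True
  then obtain x where x_in: "x \<in> points S" "\<delta> x \<noteq> 0" by blast
  have "\<delta> y = flip S (\<delta> x) y" if y_in: "y \<in> points S" for y
  proof (cases "flip_box S (\<delta> x) y")
    case True
    then show ?thesis using deviation_eq_on_flip_box[OF x_in y_in] by (simp add: flip_def)
  next
    case False
    then have "\<delta> y = 0" using flip_box_deviation[OF y_in] nonzero_deviation_unique[OF x_in y_in]
      by metis
    with False show ?thesis by (simp add: flip_def)
  qed
  then show ?thesis by blast
next
  case False
  then show ?thesis by (intro exI[of _ 0]) (simp add: flip_def)
qed

end


locale latin_avoiding_flips =
  fixes T :: "'i set" and g :: "('i \<Rightarrow> klein) \<Rightarrow> klein" and a b e :: klein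
  assumes finite: "finite T" and nonempty: "T \<noteq> {}" and latin: "latin T g"
    and distinct: "a \<noteq> 0" "b \<noteq> 0" "a \<noteq> b" "e \<noteq> a" "e \<noteq> b"
    and avoids: "x \<in> points T \<Longrightarrow> deviation T g x \<notin> {flip T a x, flip T b x, flip T e x}"
begin

abbreviation "\<delta> \<equiv> deviation T g"

lemma deviation_neq_0:
  assumes "x \<in> points T"
  shows "\<delta> x \<noteq> 0"
proof (cases "flip_box T a x \<and> flip_box T b x")
  case True
  have "x i = a + b" if "i \<in> T" for i
    using True that klein_cases[OF distinct(1-3), of "x i"] by (auto simp: flip_box_def)
  moreover have "e = 0 \<or> e = a + b" using klein_cases[OF distinct(1-3), of e] distinct by auto
  ultimately have "flip T e x = 0" using nonempty by (auto simp: flip_def flip_box_def)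
  with avoids[OF assms] show ?thesis by auto
next
  case False
  with avoids[OF assms] show ?thesis by (auto simp: flip_def)
qed

lemma deviation_eq_if_no_zeros:
  assumes "x \<in> points T" "\<And>i. i \<in> T \<Longrightarrow> x i \<noteq> 0"
  shows "\<delta> x = a + b"
  using assms
proof (induction "card {i \<in> T. x i \<noteq> a + b}" arbitrary: x rule: less_induct)
  case less
  have deviation_neq: "\<delta> x \<noteq> x i" if i_in: "i \<in> T" "x i \<noteq> a + b" for i
  proof -
    let ?y = "x(i := a + b)"
    have "{j \<in> T. ?y j \<noteq> a + b} \<subset> {j \<in> T. x j \<noteq> a + b}" using i_in by auto
    then have "card {j \<in> T. ?y j \<noteq> a + b} < card {j \<in> T. x j \<noteq> a + b}"
      using finite by (intro psubset_card_mono) auto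
    moreover have "?y j \<noteq> 0" if "j \<in> T" for j using that less.prems(2) distinct by auto
    ultimately have "\<delta> ?y = a + b" using less.hyps points_upd[OF less.prems(1) i_in(1)] by blast
    then show ?thesis
      using latin_deviation_neq_upd[OF finite latin less.prems(1) i_in] by (auto simp: klein_add_eq_iff)
  qed
  have "\<delta> x \<noteq> c" if c_cases: "c = a \<or> c = b" for c
  proof (cases "\<exists>i\<in>T. x i = c")
    case True
    then obtain i where "i \<in> T" "x i = c" by blast
    with deviation_neq[of i] c_cases distinct show ?thesis by auto
  next
    case False
    then have "flip_box T c x" using less.prems by (auto simp: flip_box_def)
    with avoids[OF less.prems(1)] c_cases show ?thesis by (auto simp: flip_def)
  qed
  then show ?case
    using klein_cases[OF distinct(1-3), of "\<delta> x"] deviation_neq_0[OF less.prems(1)] by auto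
qed

lemma deviation_eq:
  assumes "x \<in> points T"
  shows "\<delta> x = a + b"
  using assms
proof (induction "card {i \<in> T. x i = 0}" arbitrary: x rule: less_induct)
  case less
  show ?case
  proof (cases "\<exists>i\<in>T. x i = 0")
    case False
    with less.prems deviation_eq_if_no_zeros show ?thesis by blast
  next
    case True
    then obtain i where i_in: "i \<in> T" "x i = 0" by blast
    have "\<delta> x \<noteq> a + b + v" if "v \<noteq> 0" for v
    proof -
      let ?y = "x(i := v)"
      have "{j \<in> T. ?y j = 0} \<subset> {j \<in> T. x j = 0}" using i_in that by auto
      then have "card {j \<in> T. ?y j = 0} < card {j \<in> T. x j = 0}"
        using finite by (intro psubset_card_mono) auto
      then have "\<delta> ?y = a + b" using less.hyps points_upd[OF less.prems i_in(1)] by blast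
      then show ?thesis
        using latin_deviation_neq_upd[OF finite latin less.prems i_in(1), of v] i_in(2) that
        by (auto simp: add.commute)
    qed
    then have "\<delta> x + (a + b) = 0" by (metis add.commute klein_add_self_left)
    then show ?thesis by simp
  qed
qed

end

locale latin_avoiding_shift_and_flip =
  fixes T :: "'i set" and h :: "('i \<Rightarrow> klein) \<Rightarrow> klein" and a b :: klein
  assumes finite: "finite T" and latin: "latin T h"
    and distinct: "a \<noteq> 0" "b \<noteq> 0" "a \<noteq> b"
    and avoids: "x \<in> points T \<Longrightarrow> deviation T h x \<notin> {a + b, flip T a x}"
begin

abbreviation "\<delta> \<equiv> deviation T h"

lemma deviation_cases:
  assumes "x \<in> points T"
  shows "\<delta> x = b \<or> \<delta> x = a + flip T a x"
  using avoids[OF assms] klein_cases[OF distinct, of "\<delta> x"] by (auto simp: flip_def split: if_splits)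

lemma deviation_line:
  assumes x_in: "x \<in> points T" and i_in: "i \<in> T"
  shows "\<delta> (x(i := 0)) = b \<longleftrightarrow> \<delta> (x(i := a + b)) = b"
    and "\<delta> (x(i := a)) = b \<longleftrightarrow> \<delta> (x(i := b)) = b"
    and "flip_box (T - {i}) a x \<Longrightarrow> \<delta> (x(i := b)) = b \<longleftrightarrow> \<delta> (x(i := a + b)) = b"
proof -
  let ?M = "flip_box (T - {i}) a x" and ?d = "\<lambda>v. \<delta> (x(i := v))"
  have upd_in: "x(i := v) \<in> points T" for v using x_in i_in by (rule points_upd)
  have box: "flip_box T a (x(i := v)) \<longleftrightarrow> v \<noteq> 0 \<and> v \<noteq> a \<and> ?M" for v
    using i_in by (auto simp: flip_box_def)
  have axis_values: "?d 0 = a \<or> ?d 0 = b" "?d a = a \<or> ?d a = b"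
    "?d b = (if ?M then 0 else a) \<or> ?d b = b" "?d (a + b) = (if ?M then 0 else a) \<or> ?d (a + b) = b"
    using deviation_cases[OF upd_in, of 0] deviation_cases[OF upd_in, of a]
      deviation_cases[OF upd_in, of b]
      deviation_cases[OF upd_in, of "a + b"] distinct by (auto simp: flip_def box)
  note line_neq = latin_deviation_neq[OF finite latin x_in i_in]
  have line_distinct: "?d 0 \<noteq> a + ?d a" "?d 0 \<noteq> b + ?d b" "?d 0 \<noteq> a + b + ?d (a + b)"
    "a + ?d a \<noteq> b + ?d b" "a + ?d a \<noteq> a + b + ?d (a + b)" "b + ?d b \<noteq> a + b + ?d (a + b)"
    using distinct line_neq[of 0 a] line_neq[of 0 b] line_neq[of 0 "a + b"] line_neq[of a b]
      line_neq[of a "a + b"] line_neq[of b "a + b"] by simp_all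
  show "?d 0 = b \<longleftrightarrow> ?d (a + b) = b" "?d a = b \<longleftrightarrow> ?d b = b" "?M \<Longrightarrow> ?d b = b \<longleftrightarrow> ?d (a + b) = b"
    using axis_values line_distinct distinct by (cases ?M; auto simp: ac_simps)+
qed

lemma deviation_eq_iff_at_corner:
  assumes x_in: "x \<in> points T"
  shows "\<delta> x = b \<longleftrightarrow> \<delta> (\<lambda>i. if i \<in> T then a + b else 0) = b"
proof -
  define z where "z = (\<lambda>i. if i \<in> T then a + b else 0)"
  define y where "y i = (if i \<in> T then if x i \<in> {0, a + b} then a + b else b else 0)" for i
  have y_in: "y \<in> points T" and z_in: "z \<in> points T" by (simp_all add: y_def z_def points_def)
  have "\<delta> x = b \<longleftrightarrow> \<delta> y = b"
    using finite x_in y_in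
  proof (induction rule: points_change_induct)
    case start
    show ?case by simp
  next
    case (step w i)
    have "w i = y i \<or> w i = 0 \<and> y i = a + b \<or> w i = a \<and> y i = b"
      using step(2)[of i] step(3) klein_cases[OF distinct, of "x i"] by (auto simp: y_def)
    then have "\<delta> w = b \<longleftrightarrow> \<delta> (w(i := y i)) = b"
      using deviation_line(1,2)[OF step(1,3)] fun_upd_triv[of w i] by metis
    with step(4) show ?case by blast
  qed
  also have "\<dots> \<longleftrightarrow> \<delta> z = b"
    using finite y_in z_in
  proof (induction rule: points_change_induct)
    case start
    show ?case by simp
  next
    case (step w i)
    have w_cases: "w j = b \<or> w j = a + b" if "j \<in> T" for j
      using step(2)[of j] that by (auto simp: y_def z_def split: if_splits)
    then have "flip_box (T - {i}) a w" using distinct by (fastforce simp: flip_box_def)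
    then have "\<delta> w = b \<longleftrightarrow> \<delta> (w(i := a + b)) = b"
      using deviation_line(3)[OF step(1,3)] w_cases[OF step(3)] fun_upd_triv[of w i] by metis
    moreover have "z i = a + b" using step(3) by (simp add: z_def)
    ultimately show ?case using step(4) by (simp del: fun_upd_apply)
  qed
  finally show ?thesis by (simp add: z_def)
qed

lemma deviation_eq_off_flip_box:
  assumes "x \<in> points T" "y \<in> points T" "\<not> flip_box T a x" "\<not> flip_box T a y"
  shows "\<delta> x = \<delta> y"
  using deviation_cases[OF assms(1)] deviation_cases[OF assms(2)] assms(3,4)
    deviation_eq_iff_at_corner[OF assms(1)] deviation_eq_iff_at_corner[OF assms(2)]
  by (auto simp: flip_def)

end

text \<open>In a cube with four parallel slices, \<open>a\<close> is the flip of the slice at \<open>c\<close>, while \<open>b\<close> and \<open>e\<close> are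
  the flips in two other completions, with which \<open>g\<close> shares its slice at \<open>0\<close>.\<close>

locale flip_slice =
  fixes T :: "'i set" and r :: 'i and g :: "('i \<Rightarrow> klein) \<Rightarrow> klein" and a b c e :: klein
  assumes finite: "finite T" and nonempty: "T \<noteq> {}" and r_notin: "r \<notin> T"
    and latin: "latin (insert r T) g" and c_nonzero: "c \<noteq> 0"
    and distinct: "a \<noteq> 0" "b \<noteq> 0" "a \<noteq> b" "e \<noteq> a" "e \<noteq> b"
    and slice_c: "x \<in> points T \<Longrightarrow> deviation T g (x(r := c)) = flip T a x"
    and avoids: "x \<in> points T \<Longrightarrow> deviation T g x \<noteq> flip T b x \<and> deviation T g x \<noteq> flip T e x"
begin

definition slice :: "klein \<Rightarrow> ('i \<Rightarrow> klein) \<Rightarrow> klein" where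
  "slice d x = g (x(r := d))"

lemma latin_slice: "latin T (slice d)"
  using latin_slice[OF latin r_notin] by (simp add: slice_def[abs_def])

lemma deviation_slice: "deviation T (slice d) x = deviation T g (x(r := d))"
  using r_notin by (simp add: slice_def deviation_def sum_upd_notin del: fun_upd_apply)

lemma deviation_slice_neq:
  assumes "x \<in> points T" "d \<noteq> d'"
  shows "deviation T (slice d) x \<noteq> deviation T (slice d') x"
  using latin_neq[OF latin, of x r d d'] assms points_mono[of T "insert r T"]
  by (auto simp: slice_def deviation_def)

sublocale slice_0: latin_avoiding_flips T "slice 0" a b e
proof
  show "deviation T (slice 0) x \<notin> {flip T a x, flip T b x, flip T e x}" if "x \<in> points T" for x
    using that avoids[OF that] deviation_slice_neq[OF that c_nonzero[symmetric]] slice_c[OF that]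
      r_notin
    by (simp add: deviation_slice points_upd_0)
qed (use finite nonempty latin_slice distinct in auto)

lemma deviation_slice_eq_off_flip_box:
  assumes x_in: "x \<in> points T" "\<not> flip_box T a x" and y_in: "y \<in> points T" "\<not> flip_box T a y"
  shows "deviation T (slice d) x = deviation T (slice d) y"
proof -
  consider (zero) "d = 0" | (flip) "d = c" | (other) "d \<noteq> 0" "d \<noteq> c" by blast
  then show ?thesis
  proof cases
    case zero
    then show ?thesis using slice_0.deviation_eq x_in(1) y_in(1) by simp
  next
    case flip
    then show ?thesis using slice_c x_in y_in by (simp add: deviation_slice flip_def)
  next
    case other
    interpret latin_avoiding_shift_and_flip T "slice d" a b
    proof
      show "deviation T (slice d) x \<notin> {a + b, flip T a x}" if "x \<in> points T" for x
        using deviation_slice_neq[OF that other(1)] deviation_slice_neq[OF that other(2)]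
          slice_0.deviation_eq[OF that] slice_c[OF that]
        by (simp add: deviation_slice)
    qed (use finite latin_slice distinct in auto)
    show ?thesis using deviation_eq_off_flip_box x_in y_in by blast
  qed
qed

lemma boundary_eq_sum:
  assumes x_in: "x \<in> boundary (insert r T)"
  shows "g x = sum x T + g ((\<lambda>_. 0)(r := x r))"
proof -
  have x_0: "x(r := 0) \<in> points T" using x_in points_remove_upd by (auto simp: boundary_def)
  have "deviation T (slice (x r)) (x(r := 0)) = deviation T (slice (x r)) (\<lambda>_. 0)"
  proof (cases "x r = 0")
    case True
    then show ?thesis using slice_0.deviation_eq x_0 zero_mem_points by metis
  next
    case False
    then have "\<not> flip_box T a (x(r := 0))"
      using x_in r_notin by (auto simp: boundary_def flip_box_def)
    moreover have "\<not> flip_box T a (\<lambda>_. 0)" using nonempty by (auto simp: flip_box_def)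
    ultimately show ?thesis using deviation_slice_eq_off_flip_box x_0 zero_mem_points by blast
  qed
  then have "slice (x r) (x(r := 0)) = sum (x(r := 0)) T + slice (x r) (\<lambda>_. 0)"
    by (simp add: deviation_def klein_add_eq_iff ac_simps del: fun_upd_apply)
  then show ?thesis using r_notin by (simp add: slice_def sum_upd_notin del: fun_upd_apply)
qed

end

section \<open>Three completions force an affine boundary\<close>

definition slices_agree ::
    "'i set \<Rightarrow> 'i \<Rightarrow> (('i \<Rightarrow> 'v :: zero) \<Rightarrow> 'w) \<Rightarrow> (('i \<Rightarrow> 'v) \<Rightarrow> 'w) \<Rightarrow> 'v \<Rightarrow> bool" where
  "slices_agree T r f g c \<longleftrightarrow> (\<forall>x\<in>points T. f (x(r := c)) = g (x(r := c)))"

lemma latin_eq_if_three_slices_agree: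
  fixes f g :: "('i \<Rightarrow> klein) \<Rightarrow> klein"
  assumes latin_f: "latin (insert r T) f" and latin_g: "latin (insert r T) g"
    and x_in: "x \<in> points (insert r T)"
    and cs: "distinct [c0, c1, c2]" and agree: "\<And>c. c \<in> {c0, c1, c2} \<Longrightarrow> slices_agree T r f g c"
  shows "f x = g x"
proof (cases "x r \<in> {c0, c1, c2}")
  case True
  then show ?thesis
    using agree[OF True] points_remove_upd[OF x_in] by (fastforce simp: slices_agree_def)
next
  case False
  have values_eq: "f (x(r := c)) = g (x(r := c))" if "c \<in> {c0, c1, c2}" for c
    using agree[OF that] points_remove_upd[OF x_in] by (fastforce simp: slices_agree_def)
  note neq_f = latin_neq[OF latin_f x_in insertI1] and neq_g = latin_neq[OF latin_g x_in insertI1]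
  have "f (x(r := x r)) = g (x(r := x r))"
  proof (rule klein_fourth_unique[of "f (x(r := c0))" "f (x(r := c1))" "f (x(r := c2))"])
    show "distinct [f (x(r := c0)), f (x(r := c1)), f (x(r := c2))]" using cs neq_f by auto
    show "f (x(r := x r)) \<notin> {f (x(r := c0)), f (x(r := c1)), f (x(r := c2))}"
      using False neq_f[of "x r"] by blast
    show "g (x(r := x r)) \<notin> {f (x(r := c0)), f (x(r := c1)), f (x(r := c2))}"
      using False neq_g[of "x r"] values_eq by auto
  qed
  then show ?thesis by simp
qed

text \<open>On a line through such slices, both \<open>f\<close> and \<open>g\<close> avoid at \<open>c2\<close> the three values of \<open>g\<close> at
  \<open>c0\<close>, \<open>c1\<close>, \<open>c3\<close>.\<close>

lemma slices_agree_fourth: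
  fixes f g h :: "('i \<Rightarrow> klein) \<Rightarrow> klein"
  assumes latin_f: "latin (insert r T) f" and latin_g: "latin (insert r T) g"
    and latin_h: "latin (insert r T) h"
    and cs: "distinct [c0, c1, c2, c3]"
    and agree: "slices_agree T r f g c0" "slices_agree T r f g c1" "slices_agree T r f h c2"
      "slices_agree T r g h c3"
  shows "slices_agree T r f g c2"
  unfolding slices_agree_def
proof
  fix x :: "'i \<Rightarrow> klein" assume x_in: "x \<in> points T"
  then have x_in_insert: "x \<in> points (insert r T)" by (auto simp: points_def)
  note neq_f = latin_neq[OF latin_f x_in_insert insertI1]
    and neq_g = latin_neq[OF latin_g x_in_insert insertI1]
    and neq_h = latin_neq[OF latin_h x_in_insert insertI1]
  have values_eq: "f (x(r := c0)) = g (x(r := c0))" "f (x(r := c1)) = g (x(r := c1))"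
    "f (x(r := c2)) = h (x(r := c2))" "g (x(r := c3)) = h (x(r := c3))"
    using agree x_in by (auto simp: slices_agree_def)
  show "f (x(r := c2)) = g (x(r := c2))"
  proof (rule klein_fourth_unique[of "g (x(r := c0))" "g (x(r := c1))" "g (x(r := c3))"])
    show "distinct [g (x(r := c0)), g (x(r := c1)), g (x(r := c3))]" using neq_g cs by auto
    show "g (x(r := c2)) \<notin> {g (x(r := c0)), g (x(r := c1)), g (x(r := c3))}" using neq_g cs by auto
    have "f (x(r := c2)) \<noteq> g (x(r := c0))" using neq_f[of c2 c0] cs values_eq(1) by auto
    moreover have "f (x(r := c2)) \<noteq> g (x(r := c1))" using neq_f[of c2 c1] cs values_eq(2) by auto
    moreover have "f (x(r := c2)) \<noteq> g (x(r := c3))" using neq_h[of c2 c3] cs values_eq(3,4) by auto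
    ultimately show "f (x(r := c2)) \<notin> {g (x(r := c0)), g (x(r := c1)), g (x(r := c3))}" by simp
  qed
qed

lemma ex_slice_pairwise_distinct:
  fixes f g h :: "('i \<Rightarrow> klein) \<Rightarrow> klein"
  assumes latin_f: "latin (insert r T) f" and latin_g: "latin (insert r T) g"
    and latin_h: "latin (insert r T) h"
    and agree_0: "slices_agree T r f g 0" "slices_agree T r f h 0" "slices_agree T r g h 0"
    and differ: "\<exists>x\<in>points (insert r T). f x \<noteq> g x" "\<exists>x\<in>points (insert r T). f x \<noteq> h x"
      "\<exists>x\<in>points (insert r T). g x \<noteq> h x"
  shows "\<exists>c. c \<noteq> 0 \<and> \<not> slices_agree T r f g c \<and> \<not> slices_agree T r f h c \<and> \<not> slices_agree T r g h c"
proof (rule ccontr)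
  let ?E = "slices_agree T r"
  assume "\<not> ?thesis"
  then have some_agree: "?E f g c \<or> ?E f h c \<or> ?E g h c" if "c \<noteq> 0" for c using that by blast
  have unique: "\<not> (?E f g c \<and> ?E f g d)" "\<not> (?E f h c \<and> ?E f h d)" "\<not> (?E g h c \<and> ?E g h d)"
    if "distinct [0, c, d]" for c d
    using latin_eq_if_three_slices_agree[OF latin_f latin_g _ that]
      latin_eq_if_three_slices_agree[OF latin_f latin_h _ that]
      latin_eq_if_three_slices_agree[OF latin_g latin_h _ that] agree_0 differ by blast+
  have different_pairs: "\<not> (?E f g c \<and> ?E f h d \<and> ?E g h e)" if "distinct [0, c, d, e]" for c d e
    using slices_agree_fourth[OF latin_f latin_g latin_h that agree_0(1)] unique(1)[of c d] that by auto
  obtain a b c :: klein where "distinct [0, a, b, c]"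
  proof -
    have "card (UNIV - {0 :: klein}) = 3" by simp
    then obtain a b c where "UNIV - {0 :: klein} = {a, b, c}" "a \<noteq> b" "a \<noteq> c" "b \<noteq> c"
      unfolding card_3_iff by blast
    then show ?thesis using that[of a b c] by auto
  qed
  then show False
    using some_agree[of a] some_agree[of b] some_agree[of c] unique[of a b] unique[of a c]
      unique[of b c]
      different_pairs[of a b c] different_pairs[of a c b] different_pairs[of b a c]
      different_pairs[of b c a] different_pairs[of c a b] different_pairs[of c b a]
    by auto
qed

definition zero_bij :: "('i \<Rightarrow> klein \<Rightarrow> klein) \<Rightarrow> bool" where
  "zero_bij p \<longleftrightarrow> (\<forall>i. bij (p i) \<and> p i 0 = 0)"

definition relabel :: "('i \<Rightarrow> klein \<Rightarrow> klein) \<Rightarrow> ('i \<Rightarrow> klein) \<Rightarrow> 'i \<Rightarrow> klein" where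
  "relabel p x = (\<lambda>i. p i (x i))"

definition affine_on :: "('i \<Rightarrow> klein) set \<Rightarrow> 'i set \<Rightarrow> (('i \<Rightarrow> klein) \<Rightarrow> klein) \<Rightarrow> bool" where
  "affine_on X S f \<longleftrightarrow> (\<exists>u p. zero_bij p \<and> (\<forall>x\<in>X. f x = u + sum (relabel p x) S))"

lemma zero_bij_eq_0_iff: "zero_bij p \<Longrightarrow> p i v = 0 \<longleftrightarrow> v = 0"
  unfolding zero_bij_def by (metis bij_pointE)

lemma zero_bij_inv: "zero_bij p \<Longrightarrow> zero_bij (\<lambda>i. inv (p i))"
  unfolding zero_bij_def by (metis bij_imp_bij_inv bij_is_inj inv_f_eq)

lemma zero_bij_id: "zero_bij (\<lambda>_ v. v)"
  using bij_id by (simp add: zero_bij_def id_def)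

lemma relabel_inv [simp]:
  assumes "zero_bij p"
  shows "relabel p (relabel (\<lambda>i. inv (p i)) x) = x" "relabel (\<lambda>i. inv (p i)) (relabel p x) = x"
  using assms by (auto simp: relabel_def zero_bij_def bij_is_surj surj_f_inv_f bij_is_inj)

lemma relabel_mem_points_iff: "zero_bij p \<Longrightarrow> relabel p x \<in> points S \<longleftrightarrow> x \<in> points S"
  by (auto simp: points_def relabel_def zero_bij_eq_0_iff)

lemma relabel_mem_boundary_iff: "zero_bij p \<Longrightarrow> relabel p x \<in> boundary S \<longleftrightarrow> x \<in> boundary S"
  by (simp add: boundary_def relabel_mem_points_iff) (auto simp: relabel_def zero_bij_eq_0_iff)

lemma relabel_upd: "relabel p (x(i := v)) = (relabel p x)(i := p i v)"
  by (auto simp: relabel_def)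

lemma latin_relabel:
  fixes f :: "('i \<Rightarrow> klein) \<Rightarrow> klein"
  assumes "latin S f" "zero_bij p"
  shows "latin S (\<lambda>x. u + f (relabel p x))"
  unfolding latin_def
proof (intro ballI injI)
  fix x i v w
  assume "x \<in> points S" "i \<in> S" "u + f (relabel p (x(i := v))) = u + f (relabel p (x(i := w)))"
  then have "p i v = p i w"
    using latin_neq[OF assms(1), of "relabel p x" i "p i v" "p i w"] assms(2)
    by (auto simp: relabel_upd relabel_mem_points_iff)
  then show "v = w" using assms(2) unfolding zero_bij_def by (metis bij_pointE)
qed

lemma latin_affine:
  assumes "finite S" "zero_bij p"
  shows "latin S (\<lambda>x. u + sum (relabel p x) S)"
proof -
  have "latin S (\<lambda>x. sum x S :: klein)"
    unfolding latin_def using assms(1) by (auto simp: inj_def sum_upd simp del: fun_upd_apply)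
  from latin_relabel[OF this assms(2)] show ?thesis .
qed

lemma affine_on_boundary_relabel:
  fixes f :: "('i \<Rightarrow> klein) \<Rightarrow> klein"
  assumes "zero_bij p" "affine_on (boundary S) S (\<lambda>x. u + f (relabel p x))"
  shows "affine_on (boundary S) S f"
proof -
  obtain w q where zero_bij_q: "zero_bij q"
    and relabelled_eq: "\<And>x. x \<in> boundary S \<Longrightarrow> u + f (relabel p x) = w + sum (relabel q x) S"
    using assms(2) by (auto simp: affine_on_def)
  let ?p' = "\<lambda>i. inv (p i)"
  have zero_bij_p': "zero_bij ?p'" using assms(1) by (rule zero_bij_inv)
  have "f x = (u + w) + sum (relabel (\<lambda>i. q i \<circ> ?p' i) x) S" if "x \<in> boundary S" for x
  proof -
    have "u + f x = w + sum (relabel q (relabel ?p' x)) S"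
      using relabelled_eq[of "relabel ?p' x"] that zero_bij_p' assms(1)
      by (simp add: relabel_mem_boundary_iff)
    then show ?thesis by (simp add: klein_add_eq_iff relabel_def ac_simps)
  qed
  moreover have "zero_bij (\<lambda>i. q i \<circ> ?p' i)"
    using zero_bij_p' zero_bij_q by (simp add: zero_bij_def bij_comp)
  ultimately show ?thesis unfolding affine_on_def by blast
qed

lemma zero_bij_line:
  fixes f :: "('i \<Rightarrow> klein) \<Rightarrow> klein"
  assumes "latin S f" "x \<in> points S" "i \<in> S" "x i = 0" "zero_bij p"
  shows "zero_bij (p(i := (\<lambda>v. f (x(i := v)) + f x)))"
proof -
  have "inj (\<lambda>v. f (x(i := v)) + f x)"
    using assms(1-3) by (auto simp: latin_def inj_def)
  then have "bij (\<lambda>v. f (x(i := v)) + f x)" by (simp add: bij_def finite_UNIV_inj_surj)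
  moreover have "x(i := 0) = x" using assms(4) by auto
  ultimately show ?thesis using assms(5) by (auto simp: zero_bij_def)
qed

lemma affine_on_boundary_if_sum_plus_axis:
  assumes "finite T" "r \<notin> T" "latin (insert r T) f"
    and boundary_eq: "\<And>x. x \<in> boundary (insert r T) \<Longrightarrow> f x = sum x T + f ((\<lambda>_. 0)(r := x r))"
  shows "affine_on (boundary (insert r T)) (insert r T) f"
proof -
  define p where "p = (\<lambda>_ v. v)(r := (\<lambda>v. f ((\<lambda>_. 0)(r := v)) + f (\<lambda>_. 0)))"
  have "zero_bij p"
    unfolding p_def using assms(3) zero_mem_points by (rule zero_bij_line) (simp_all add: zero_bij_id)
  moreover have "f x = f (\<lambda>_. 0) + sum (relabel p x) (insert r T)" if "x \<in> boundary (insert r T)" for x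
  proof -
    have "sum (relabel p x) T = sum x T"
      using assms(2) by (intro sum.cong) (auto simp: relabel_def p_def)
    then have "sum (relabel p x) (insert r T) = f ((\<lambda>_. 0)(r := x r)) + f (\<lambda>_. 0) + sum x T"
      using assms(1,2) by (simp add: relabel_def p_def)
    then show ?thesis using boundary_eq[OF that] by (simp add: ac_simps)
  qed
  ultimately show ?thesis unfolding affine_on_def by blast
qed

lemma affine_on_boundary_pair:
  assumes "r \<noteq> t" "latin {r, t} f"
  shows "affine_on (boundary {r, t}) {r, t} f"
proof -
  define p where "p = (\<lambda>_ v. v)(r := (\<lambda>v. f ((\<lambda>_. 0)(r := v)) + f (\<lambda>_. 0)),
    t := (\<lambda>v. f ((\<lambda>_. 0)(t := v)) + f (\<lambda>_. 0)))"
  have "zero_bij p"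
    unfolding p_def
    by (intro zero_bij_line[OF assms(2) zero_mem_points]) (simp_all add: zero_bij_id)
  moreover have "f x = f (\<lambda>_. 0) + sum (relabel p x) {r, t}" if x_in: "x \<in> boundary {r, t}" for x
  proof -
    have p_axis: "p r v = f ((\<lambda>_. 0)(r := v)) + f (\<lambda>_. 0)"
      "p t v = f ((\<lambda>_. 0)(t := v)) + f (\<lambda>_. 0)" for v
      using assms(1) by (simp_all add: p_def)
    have sum_pair: "sum (relabel p x) {r, t} = p r (x r) + p t (x t)"
      using assms(1) by (simp add: relabel_def)
    consider (t_axis) "x r = 0" "x = (\<lambda>_. 0)(t := x t)" | (r_axis) "x t = 0" "x = (\<lambda>_. 0)(r := x r)"
    proof -
      have outside: "x i = 0" if "i \<noteq> r" "i \<noteq> t" for i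
        using x_in that by (simp add: boundary_def points_def)
      have "x = (\<lambda>_. 0)(t := x t)" if "x r = 0"
        by (rule ext) (use outside that in force)
      moreover have "x = (\<lambda>_. 0)(r := x r)" if "x t = 0"
        by (rule ext) (use outside that in force)
      ultimately show ?thesis using that x_in by (auto simp: boundary_def)
    qed
    then show ?thesis
    proof cases
      case t_axis
      then have "p r (x r) = 0" using \<open>zero_bij p\<close> by (simp add: zero_bij_eq_0_iff)
      then show ?thesis using t_axis(2) by (simp add: sum_pair p_axis)
    next
      case r_axis
      then have "p t (x t) = 0" using \<open>zero_bij p\<close> by (simp add: zero_bij_eq_0_iff)
      then show ?thesis using r_axis(2) by (simp add: sum_pair p_axis)
    qed
  qed
  ultimately show ?thesis unfolding affine_on_def by blast
qed

lemma deviation_neq_flip_if_slice_flip: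
  assumes "r \<notin> T" "c \<noteq> 0" "latin (insert r T) l" "x \<in> points T" "l x = k x"
    and slice: "deviation T l (x(r := c)) = flip T d x"
  shows "deviation T k x \<noteq> flip T d x"
proof -
  have "x r \<noteq> c" "x \<in> points (insert r T)" using assms(1,2,4) by (auto simp: points_def)
  then have "l x \<noteq> l (x(r := c))" using latin_neq_upd[OF assms(3)] by simp
  moreover have "deviation T l (x(r := c)) = l (x(r := c)) + sum x T"
    using assms(1) by (simp add: deviation_def sum_upd_notin del: fun_upd_apply)
  ultimately show ?thesis using assms(5) slice by (metis add_right_cancel deviation_def)
qed

lemma points_subset_boundary_insert: "r \<notin> T \<Longrightarrow> points T \<subseteq> boundary (insert r T)"
  by (auto simp: boundary_def points_def)

lemma three_flip_slices_imp_boundary_sum: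
  fixes f g h :: "('i \<Rightarrow> klein) \<Rightarrow> klein"
  assumes T_props: "finite T" "T \<noteq> {}" "r \<notin> T"
    and latin: "latin (insert r T) f" "latin (insert r T) g" "latin (insert r T) h"
    and boundary_eq: "\<And>x. x \<in> boundary (insert r T) \<Longrightarrow> g x = f x"
      "\<And>x. x \<in> boundary (insert r T) \<Longrightarrow> h x = f x"
    and c_nonzero: "c \<noteq> 0" and distinct: "a \<noteq> b" "a \<noteq> e" "b \<noteq> e"
    and slices: "\<And>x. x \<in> points T \<Longrightarrow> deviation T f (x(r := c)) = flip T a x"
      "\<And>x. x \<in> points T \<Longrightarrow> deviation T g (x(r := c)) = flip T b x"
      "\<And>x. x \<in> points T \<Longrightarrow> deviation T h (x(r := c)) = flip T e x"
    and x_in: "x \<in> boundary (insert r T)"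
  shows "f x = sum x T + f ((\<lambda>_. 0)(r := x r))"
proof -
  have eq_on_points: "g y = f y" "h y = f y" if "y \<in> points T" for y
    using boundary_eq points_subset_boundary_insert[OF T_props(3)] that by blast+
  note neq_flip = deviation_neq_flip_if_slice_flip[OF T_props(3) c_nonzero]
  have avoids_e: "deviation T f y \<noteq> flip T e y" and avoids_b: "deviation T f y \<noteq> flip T b y"
    and g_avoids: "deviation T g y \<noteq> flip T a y" "deviation T g y \<noteq> flip T e y"
    if y_in: "y \<in> points T" for y
    using neq_flip[OF latin(1) y_in _ slices(1)[OF y_in]]
      neq_flip[OF latin(2) y_in _ slices(2)[OF y_in]]
      neq_flip[OF latin(3) y_in _ slices(3)[OF y_in]] eq_on_points[OF y_in] by simp_all
  \<comment> \<open>At least two of the three flips are nonzero.\<close>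
  consider (f_g) "a \<noteq> 0" "b \<noteq> 0" | (f_h) "a \<noteq> 0" "e \<noteq> 0" | (g_h) "b \<noteq> 0" "e \<noteq> 0"
    using distinct by blast
  then show ?thesis
  proof cases
    case f_g
    interpret flip_slice T r f a b c e
      using T_props latin(1) c_nonzero f_g distinct slices(1) avoids_b avoids_e by unfold_locales auto
    show ?thesis using x_in by (rule boundary_eq_sum)
  next
    case f_h
    interpret flip_slice T r f a e c b
      using T_props latin(1) c_nonzero f_h distinct slices(1) avoids_b avoids_e by unfold_locales auto
    show ?thesis using x_in by (rule boundary_eq_sum)
  next
    case g_h
    interpret flip_slice T r g b e c a
      using T_props latin(2) c_nonzero g_h distinct slices(2) g_avoids by unfold_locales auto
    have "(\<lambda>_. 0)(r := x r) \<in> boundary (insert r T)"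
      using T_props(2,3) by (auto simp: boundary_def points_def)
    then show ?thesis using boundary_eq_sum[OF x_in] boundary_eq(1) x_in by simp
  qed
qed

definition pairwise_differ_on :: "'x set \<Rightarrow> ('x \<Rightarrow> 'y) \<Rightarrow> ('x \<Rightarrow> 'y) \<Rightarrow> ('x \<Rightarrow> 'y) \<Rightarrow> bool" where
  "pairwise_differ_on X f g h \<longleftrightarrow>
     (\<exists>x\<in>X. f x \<noteq> g x) \<and> (\<exists>x\<in>X. f x \<noteq> h x) \<and> (\<exists>x\<in>X. g x \<noteq> h x)"

lemma ex_deviation_slice_eq_flip:
  assumes T_props: "finite T" "card T \<ge> 2" "r \<notin> T" and latin_f: "latin (insert r T) f"
    and slice_sum: "\<And>x. x \<in> boundary T \<Longrightarrow> f (x(r := c)) = sum x T"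
  shows "\<exists>a. \<forall>x\<in>points T. deviation T f (x(r := c)) = flip T a x"
proof -
  interpret latin_sum_boundary T "\<lambda>x. f (x(r := c))"
    using T_props latin_slice[OF latin_f] slice_sum by unfold_locales auto
  show ?thesis
    using ex_deviation_eq_flip T_props(3) by (simp add: deviation_def sum_upd_notin del: fun_upd_apply)
qed

lemma affine_on_boundary_if_sum_slice:
  fixes f g h :: "('i \<Rightarrow> klein) \<Rightarrow> klein"
  assumes T_props: "finite T" "card T \<ge> 2" "r \<notin> T"
    and latin: "latin (insert r T) f" "latin (insert r T) g" "latin (insert r T) h"
    and boundary_eq: "\<And>x. x \<in> boundary (insert r T) \<Longrightarrow> g x = f x"
      "\<And>x. x \<in> boundary (insert r T) \<Longrightarrow> h x = f x"
    and c_nonzero: "c \<noteq> 0" and slice_sum: "\<And>x. x \<in> boundary T \<Longrightarrow> f (x(r := c)) = sum x T"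
    and differ: "pairwise_differ_on ((\<lambda>x. x(r := c)) ` points T) f g h"
  shows "affine_on (boundary (insert r T)) (insert r T) f"
proof -
  have "x(r := c) \<in> boundary (insert r T)" if "x \<in> boundary T" for x
    using that T_props(3) by (auto simp: boundary_def points_def)
  then have slice_sums: "g (x(r := c)) = sum x T" "h (x(r := c)) = sum x T" if "x \<in> boundary T" for x
    using boundary_eq slice_sum that by simp_all
  obtain a where flip_a: "\<And>x. x \<in> points T \<Longrightarrow> deviation T f (x(r := c)) = flip T a x"
    using ex_deviation_slice_eq_flip[OF T_props latin(1) slice_sum] by blast
  obtain b where flip_b: "\<And>x. x \<in> points T \<Longrightarrow> deviation T g (x(r := c)) = flip T b x"
    using ex_deviation_slice_eq_flip[OF T_props latin(2) slice_sums(1)] by blast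
  obtain e where flip_e: "\<And>x. x \<in> points T \<Longrightarrow> deviation T h (x(r := c)) = flip T e x"
    using ex_deviation_slice_eq_flip[OF T_props latin(3) slice_sums(2)] by blast
  have flips_neq: "d \<noteq> d'"
    if differ_kl: "\<exists>x\<in>(\<lambda>x. x(r := c)) ` points T. k x \<noteq> l x"
      and flip_d: "\<And>x. x \<in> points T \<Longrightarrow> deviation T k (x(r := c)) = flip T d x"
      and flip_d': "\<And>x. x \<in> points T \<Longrightarrow> deviation T l (x(r := c)) = flip T d' x" for k l d d'
  proof -
    obtain x where x_in: "x \<in> points T" "k (x(r := c)) \<noteq> l (x(r := c))" using differ_kl by blast
    then have "deviation T k (x(r := c)) \<noteq> deviation T l (x(r := c))" by (simp add: deviation_def)
    then show ?thesis using flip_d[OF x_in(1)] flip_d'[OF x_in(1)] by auto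
  qed
  have "a \<noteq> b" "a \<noteq> e" "b \<noteq> e"
    using differ flips_neq[OF _ flip_a flip_b] flips_neq[OF _ flip_a flip_e]
      flips_neq[OF _ flip_b flip_e] by (auto simp: pairwise_differ_on_def)
  moreover have "T \<noteq> {}" using T_props(2) by auto
  ultimately have "f x = sum x T + f ((\<lambda>_. 0)(r := x r))" if "x \<in> boundary (insert r T)" for x
    using three_flip_slices_imp_boundary_sum[OF T_props(1) _ T_props(3) latin boundary_eq c_nonzero _ _ _
        flip_a flip_b flip_e that] by blast
  then show ?thesis by (intro affine_on_boundary_if_sum_plus_axis T_props(1,3) latin(1))
qed

lemma affine_on_boundary_if_affine_slice:
  fixes f g h :: "('i \<Rightarrow> klein) \<Rightarrow> klein"
  assumes T_props: "finite T" "card T \<ge> 2" "r \<notin> T"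
    and latin: "latin (insert r T) f" "latin (insert r T) g" "latin (insert r T) h"
    and boundary_eq: "\<And>x. x \<in> boundary (insert r T) \<Longrightarrow> g x = f x"
      "\<And>x. x \<in> boundary (insert r T) \<Longrightarrow> h x = f x"
    and c_nonzero: "c \<noteq> 0" and affine: "affine_on (boundary T) T (\<lambda>x. f (x(r := c)))"
    and differ: "pairwise_differ_on ((\<lambda>x. x(r := c)) ` points T) f g h"
  shows "affine_on (boundary (insert r T)) (insert r T) f"
proof -
  obtain u p where zero_bij_p: "zero_bij p"
    and slice: "\<And>x. x \<in> boundary T \<Longrightarrow> f (x(r := c)) = u + sum (relabel p x) T"
    using affine by (auto simp: affine_on_def)
  let ?q = "\<lambda>i. inv (p i)"
  have zero_bij_q: "zero_bij ?q" using zero_bij_p by (rule zero_bij_inv)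
  define F where "F k x = u + k (relabel ?q x)" for k :: "('i \<Rightarrow> klein) \<Rightarrow> klein" and x
  have latin_F: "latin (insert r T) (F k)" if "latin (insert r T) k" for k
    unfolding F_def using that zero_bij_q by (rule latin_relabel)
  have "inv (p r) (p r c) = c" using zero_bij_p by (simp add: zero_bij_def bij_is_inj)
  then have F_slice: "F k (x(r := p r c)) = u + k ((relabel ?q x)(r := c))" for k x
    by (simp add: F_def relabel_upd)
  have "affine_on (boundary (insert r T)) (insert r T) (F f)"
  proof (rule affine_on_boundary_if_sum_slice[OF T_props latin_F latin_F latin_F])
    show "latin (insert r T) f" "latin (insert r T) g" "latin (insert r T) h" using latin .
    show "F g x = F f x" "F h x = F f x" if "x \<in> boundary (insert r T)" for x
      using boundary_eq that zero_bij_q by (simp_all add: F_def relabel_mem_boundary_iff)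
    show "p r c \<noteq> 0" using zero_bij_p c_nonzero by (simp add: zero_bij_eq_0_iff)
    show "F f (x(r := p r c)) = sum x T" if "x \<in> boundary T" for x
      using slice[of "relabel ?q x"] that zero_bij_p zero_bij_q
      by (simp add: F_slice relabel_mem_boundary_iff)
    have F_differ: "\<exists>x\<in>(\<lambda>x. x(r := p r c)) ` points T. F k x \<noteq> F l x"
      if differ_kl: "\<exists>x\<in>(\<lambda>x. x(r := c)) ` points T. k x \<noteq> l x" for k l
    proof -
      obtain x where "x \<in> points T" "k (x(r := c)) \<noteq> l (x(r := c))" using differ_kl by blast
      then have "relabel p x \<in> points T"
        "F k ((relabel p x)(r := p r c)) \<noteq> F l ((relabel p x)(r := p r c))"
        using zero_bij_p by (simp_all add: F_slice relabel_mem_points_iff)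
      then show ?thesis by blast
    qed
    show "pairwise_differ_on ((\<lambda>x. x(r := p r c)) ` points T) (F f) (F g) (F h)"
      using differ F_differ by (simp add: pairwise_differ_on_def)
  qed
  then show ?thesis unfolding F_def by (rule affine_on_boundary_relabel[OF zero_bij_q])
qed

theorem three_completions_affine:
  fixes f g h :: "('i \<Rightarrow> klein) \<Rightarrow> klein"
  assumes "finite S" "card S \<ge> 2" "latin S f" "latin S g" "latin S h"
    and "\<And>x. x \<in> boundary S \<Longrightarrow> g x = f x" "\<And>x. x \<in> boundary S \<Longrightarrow> h x = f x"
    and "pairwise_differ_on (points S) f g h"
  shows "affine_on (boundary S) S f"
  using assms
proof (induction S arbitrary: f g h rule: finite_induct)
  case empty
  then show ?case by simp
next
  case (insert r T)
  note latin = insert.prems(2-4) and boundary_eq = insert.prems(5,6)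
  show ?case
  proof (cases "card T \<ge> 2")
    case False
    then have "card T = 1" using insert.prems(1) insert.hyps by simp
    then obtain t where "T = {t}" by (auto simp: card_1_singleton_iff)
    then show ?thesis using affine_on_boundary_pair[of r t f] insert.hyps(2) latin(1) by simp
  next
    case True
    have "g x = f x" "h x = f x" if "x \<in> points T" for x
      using boundary_eq points_subset_boundary_insert[OF insert.hyps(2)] that by blast+
    then have "slices_agree T r f g 0" "slices_agree T r f h 0" "slices_agree T r g h 0"
      using insert.hyps(2) by (simp_all add: slices_agree_def points_upd_0)
    then obtain c where c_props: "c \<noteq> 0" "\<not> slices_agree T r f g c" "\<not> slices_agree T r f h c"
        "\<not> slices_agree T r g h c"
      using ex_slice_pairwise_distinct[OF latin] insert.prems(7) by (auto simp: pairwise_differ_on_def)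
    have boundary_upd: "x(r := c) \<in> boundary (insert r T)" if "x \<in> boundary T" for x
      using that insert.hyps(2) by (auto simp: boundary_def points_def)
    have "affine_on (boundary T) T (\<lambda>x. f (x(r := c)))"
    proof (rule insert.IH[OF True])
      show "latin T (\<lambda>x. f (x(r := c)))" "latin T (\<lambda>x. g (x(r := c)))" "latin T (\<lambda>x. h (x(r := c)))"
        using latin insert.hyps(2) by (auto intro: latin_slice)
      show "pairwise_differ_on (points T) (\<lambda>x. f (x(r := c))) (\<lambda>x. g (x(r := c))) (\<lambda>x. h (x(r := c)))"
        using c_props by (auto simp: slices_agree_def pairwise_differ_on_def)
    qed (use boundary_eq boundary_upd in blast)+
    moreover have "pairwise_differ_on ((\<lambda>x. x(r := c)) ` points T) f g h"
      using c_props by (auto simp: slices_agree_def pairwise_differ_on_def)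
    ultimately show ?thesis
      using affine_on_boundary_if_affine_slice[OF insert.hyps(1) True insert.hyps(2) latin boundary_eq
          c_props(1)]
      by blast
  qed
qed

section \<open>Index families on the subset lattice\<close>

text \<open>\<open>c S\<close> is the index of the completion chosen on \<open>S\<close>, with \<open>0\<close> for an affine one; above a set with
  a non-affine choice only two indices are left.\<close>

definition index_families :: "'a set set \<Rightarrow> ('a set \<Rightarrow> nat) set" where
  "index_families A = {c \<in> A \<rightarrow>\<^sub>E {..<4}. \<forall>S\<in>A. \<forall>T\<in>A. T \<subset> S \<longrightarrow> c T \<noteq> 0 \<longrightarrow> c S < 2}"

lemma finite_index_families: "finite A \<Longrightarrow> finite (index_families A)"
  unfolding index_families_def by (rule finite_subset[OF Collect_restrict]) (simp add: finite_PiE)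

lemma index_families_empty [simp]: "index_families {} = {\<lambda>_. undefined}"
  by (simp add: index_families_def)

lemma restrict_index_families:
  assumes "c \<in> index_families A" "B \<subseteq> A"
  shows "restrict c B \<in> index_families B"
proof -
  have "c S < 4" if "S \<in> B" for S using assms that by (auto simp: index_families_def PiE_iff)
  moreover have "c S < 2" if "S \<in> B" "T \<in> B" "T \<subset> S" "c T \<noteq> 0" for S T
    using assms that unfolding index_families_def by blast
  ultimately show ?thesis by (simp add: index_families_def PiE_iff)
qed

lemma inj_on_restrict_pair: "inj_on (\<lambda>c. (restrict c A, restrict c B)) (extensional (A \<union> B))"
proof (rule inj_onI)
  fix c d assume cd_extensional: "c \<in> extensional (A \<union> B)" "d \<in> extensional (A \<union> B)"
    and images_eq: "(restrict c A, restrict c B) = (restrict d A, restrict d B)"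
  have "c x = d x" if "x \<in> A \<union> B" for x
    using images_eq that by (metis Pair_inject Un_iff restrict_apply')
  with cd_extensional show "c = d" by (rule extensionalityI)
qed

lemma index_families_subset_extensional: "index_families A \<subseteq> extensional A"
  by (auto simp: index_families_def PiE_def)

lemma card_index_families_Un:
  assumes "finite A" "finite B"
  shows "card (index_families (A \<union> B)) \<le> card (index_families A) * card (index_families B)"
proof -
  have "card (index_families (A \<union> B)) \<le> card (index_families A \<times> index_families B)"
  proof (rule card_inj_on_le)
    show "inj_on (\<lambda>c. (restrict c A, restrict c B)) (index_families (A \<union> B))"
      using inj_on_restrict_pair index_families_subset_extensional by (rule inj_on_subset)
    show "(\<lambda>c. (restrict c A, restrict c B)) ` index_families (A \<union> B) \<subseteq>
        index_families A \<times> index_families B"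
      using restrict_index_families by blast
  qed (use assms in \<open>simp add: finite_index_families\<close>)
  then show ?thesis by (simp add: card_cartesian_product)
qed

lemma card_index_families_insert_below:
  assumes finite_A: "finite A" and below: "\<And>S. S \<in> A \<Longrightarrow> U \<subset> S"
  shows "card (index_families (insert U A)) \<le> card (index_families A) + 3 * 2 ^ card A"
proof -
  let ?affine = "{0 :: nat} \<times> index_families A"
    and ?nonaffine = "{1..<4 :: nat} \<times> (A \<rightarrow>\<^sub>E {..<2 :: nat})"
  let ?split = "\<lambda>c. (c U, restrict c A)"
  have "card (index_families (insert U A)) \<le> card (?affine \<union> ?nonaffine)"
  proof (rule card_inj_on_le)
    show "inj_on ?split (index_families (insert U A))"
    proof (rule inj_onI)
      fix c d assume "c \<in> index_families (insert U A)" "d \<in> index_families (insert U A)"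
        and images_eq: "?split c = ?split d"
      then have "c \<in> extensional (insert U A)" "d \<in> extensional (insert U A)"
        using index_families_subset_extensional by blast+
      moreover have "c S = d S" if "S \<in> insert U A" for S
        using images_eq that by (metis Pair_inject insertE restrict_apply')
      ultimately show "c = d" by (rule extensionalityI)
    qed
    show "?split ` index_families (insert U A) \<subseteq> ?affine \<union> ?nonaffine"
    proof (intro image_subsetI)
      fix c assume c_in: "c \<in> index_families (insert U A)"
      have "c U < 4" using c_in by (auto simp: index_families_def)
      moreover have "c S < 2" if "S \<in> A" "c U \<noteq> 0" for S
        using c_in below[OF that(1)] that by (auto simp: index_families_def)
      ultimately show "?split c \<in> ?affine \<union> ?nonaffine"
        using restrict_index_families[OF c_in subset_insertI] by auto
    qed
    show "finite (?affine \<union> ?nonaffine)"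
      using finite_A by (intro finite_UnI finite_SigmaI finite_index_families finite_PiE) simp_all
  qed
  also have "\<dots> \<le> card ?affine + card ?nonaffine" by (rule card_Un_le)
  also have "\<dots> = card (index_families A) + 3 * 2 ^ card A"
    using finite_A by (simp add: card_cartesian_product card_PiE)
  finally show ?thesis .
qed

lemma card_index_families_chain:
  "sorted_wrt (\<subset>) Us \<Longrightarrow> card (index_families (set Us)) + 2 \<le> 3 * 2 ^ length Us"
proof (induction Us)
  case (Cons U Us)
  then have "card (index_families (set (U # Us)))
      \<le> card (index_families (set Us)) + 3 * 2 ^ card (set Us)"
    using card_index_families_insert_below[of "set Us" U] by simp
  also have "\<dots> \<le> card (index_families (set Us)) + 3 * 2 ^ length Us"
    by (intro add_left_mono mult_left_mono power_increasing card_length) simp_all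
  finally show ?case using Cons by simp
qed simp

definition grid :: "'a set \<Rightarrow> 'a set list \<Rightarrow> 'a set set" where
  "grid K Us = (\<lambda>(X, U). X \<union> U) ` (Pow K \<times> set Us)"

lemma finite_grid: "finite K \<Longrightarrow> finite (grid K Us)"
  by (simp add: grid_def)

lemma mem_grid_iff: "Y \<in> grid K Us \<longleftrightarrow> (\<exists>X U. X \<subseteq> K \<and> U \<in> set Us \<and> Y = X \<union> U)"
  by (auto simp: grid_def)

lemma grid_insert:
  "grid (insert a K) (Vs @ [V]) = grid K (Vs @ [V, insert a V]) \<union> grid K (map (insert a) Vs)"
proof (intro equalityI subsetI)
  fix Y assume "Y \<in> grid (insert a K) (Vs @ [V])"
  then obtain X U where Y_eq: "Y = X \<union> U" "X \<subseteq> insert a K" "U \<in> set (Vs @ [V])"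
    by (auto simp: mem_grid_iff)
  show "Y \<in> grid K (Vs @ [V, insert a V]) \<union> grid K (map (insert a) Vs)"
  proof (cases "a \<in> X")
    case True
    then have "Y = (X - {a}) \<union> insert a U" "X - {a} \<subseteq> K" using Y_eq by auto
    moreover have "insert a U \<in> set (Vs @ [V, insert a V]) \<union> set (map (insert a) Vs)"
      using Y_eq(3) by auto
    ultimately show ?thesis unfolding Un_iff mem_grid_iff by blast
  next
    case False
    then have "X \<subseteq> K" "U \<in> set (Vs @ [V, insert a V])" using Y_eq(2,3) by auto
    with Y_eq(1) show ?thesis unfolding Un_iff mem_grid_iff by blast
  qed
next
  fix Y assume "Y \<in> grid K (Vs @ [V, insert a V]) \<union> grid K (map (insert a) Vs)"
  then obtain X U where Y_eq: "Y = X \<union> U" "X \<subseteq> K"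
      "U \<in> set (Vs @ [V, insert a V]) \<union> set (map (insert a) Vs)"
    unfolding Un_iff mem_grid_iff by blast
  then consider (old) "U \<in> set (Vs @ [V])" | (inserted) W where "W \<in> set (Vs @ [V])" "U = insert a W"
    by auto
  then show "Y \<in> grid (insert a K) (Vs @ [V])"
  proof cases
    case old
    with Y_eq(1,2) show ?thesis unfolding mem_grid_iff by blast
  next
    case inserted
    then have "Y = insert a X \<union> W" "insert a X \<subseteq> insert a K" using Y_eq by auto
    with inserted(1) show ?thesis unfolding mem_grid_iff by blast
  qed
qed

text \<open>The number of chains in the symmetric chain decomposition of the product of a \<open>k\<close>-dimensional cube
  with a chain of length \<open>l\<close>.\<close>

fun chain_count :: "nat \<Rightarrow> nat \<Rightarrow> nat" where
  "chain_count 0 l = (if l = 0 then 0 else 1)"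
| "chain_count (Suc k) 0 = 0"
| "chain_count (Suc k) (Suc l) = chain_count k (Suc (Suc l)) + chain_count k l"

lemma sorted_wrt_psubset_map_insert:
  assumes "sorted_wrt (\<subset>) Us" "\<And>U. U \<in> set Us \<Longrightarrow> a \<notin> U"
  shows "sorted_wrt (\<subset>) (map (insert a) Us)"
  unfolding sorted_wrt_map
proof (rule sorted_wrt_mono_rel[OF _ assms(1)])
  fix U W assume "U \<in> set Us" "W \<in> set Us" "U \<subset> W"
  then show "insert a U \<subset> insert a W" using assms(2)[of U] assms(2)[of W] by auto
qed

lemma card_index_families_grid:
  assumes "finite K" "sorted_wrt (\<subset>) Us" "\<And>U. U \<in> set Us \<Longrightarrow> U \<inter> K = {}"
  shows "card (index_families (grid K Us)) \<le>
    2 ^ (length Us * 2 ^ card K) * 3 ^ chain_count (card K) (length Us)"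
  using assms
proof (induction K arbitrary: Us rule: finite_induct)
  case empty
  have "grid {} Us = set Us" by (auto simp: grid_def)
  then show ?case using card_index_families_chain[OF empty(1)] by (cases Us) auto
next
  case (insert a K)
  show ?case
  proof (cases Us rule: rev_cases)
    case Nil
    then show ?thesis by (simp add: grid_def)
  next
    case (snoc Vs V)
    let ?Us' = "Vs @ [V, insert a V]" and ?Us'' = "map (insert a) Vs"
    let ?bound = "\<lambda>Ws. 2 ^ (length Ws * 2 ^ card K) * 3 ^ chain_count (card K) (length Ws) :: nat"
    have sorted: "sorted_wrt (\<subset>) Vs" "\<And>U. U \<in> set Vs \<Longrightarrow> U \<subset> V"
      using insert.prems(1) by (auto simp: snoc sorted_wrt_append)
    have fresh: "a \<notin> U" "U \<inter> K = {}" if "U \<in> set Us" for U using insert.prems(2)[OF that] by auto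
    have "sorted_wrt (\<subset>) ?Us'"
      using sorted fresh(1)[of V] by (auto simp: snoc sorted_wrt_append)
    moreover have "sorted_wrt (\<subset>) ?Us''"
      using sorted(1) fresh(1) by (intro sorted_wrt_psubset_map_insert) (simp_all add: snoc)
    moreover have "U \<inter> K = {}" if "U \<in> set ?Us' \<union> set ?Us''" for U
      using that fresh insert.hyps(2) by (fastforce simp: snoc)
    ultimately have "card (index_families (grid K ?Us')) \<le> ?bound ?Us'"
      "card (index_families (grid K ?Us'')) \<le> ?bound ?Us''"
      by (intro insert.IH; blast)+
    then have "card (index_families (grid (insert a K) Us)) \<le> ?bound ?Us' * ?bound ?Us''"
      using card_index_families_Un[OF finite_grid finite_grid, OF insert.hyps(1) insert.hyps(1)]
      unfolding snoc grid_insert by (meson le_trans mult_le_mono)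
    also have "\<dots> = 2 ^ ((length ?Us' + length ?Us'') * 2 ^ card K) *
        3 ^ (chain_count (card K) (length ?Us') + chain_count (card K) (length ?Us''))"
      by (simp add: power_add add_mult_distrib)
    also have "length ?Us' + length ?Us'' = 2 * length Us" by (simp add: snoc)
    also have "chain_count (card K) (length ?Us') + chain_count (card K) (length ?Us'') =
        chain_count (card (insert a K)) (length Us)"
      using insert.hyps by (simp add: snoc)
    finally show ?thesis using insert.hyps by (simp add: mult.assoc mult.left_commute)
  qed
qed

lemma card_index_families_Pow:
  assumes "finite K"
  shows "card (index_families (Pow K)) \<le> 2 ^ 2 ^ card K * 3 ^ chain_count (card K) 1"
proof -
  have "grid K [{}] = Pow K" by (auto simp: grid_def)
  then show ?thesis using card_index_families_grid[OF assms, of "[{}]"] by simp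
qed

lemma chain_count_0_right: "chain_count k 0 = 0"
  by (cases k) auto

lemma chain_count_Suc_le: "chain_count (Suc k) l \<le> 2 * chain_count k l"
proof (induction k arbitrary: l)
  case 0
  then show ?case by (cases l) auto
next
  case (Suc k)
  show ?case
  proof (cases l)
    case (Suc j)
    have "chain_count (Suc (Suc k)) (Suc j) = chain_count (Suc k) (Suc (Suc j)) + chain_count (Suc k) j"
      by (rule chain_count.simps)
    also have "\<dots> \<le> 2 * (chain_count k (Suc (Suc j)) + chain_count k j)"
      unfolding add_mult_distrib2 by (intro add_mono Suc.IH)
    finally show ?thesis by (simp only: Suc chain_count.simps)
  qed simp
qed

lemma chain_count_le: "chain_count k l \<le> 2 ^ k"
proof (induction k)
  case (Suc k)
  then show ?case using chain_count_Suc_le[of k l] by simp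
qed simp

lemma bounded_harmonic_eq_0:
  fixes L :: "nat \<Rightarrow> real"
  assumes "L 0 = 0" and harmonic: "\<And>l. 2 * L (Suc l) = L (Suc (Suc l)) + L l"
    and bounds: "\<And>l. 0 \<le> L l" "\<And>l. L l \<le> B"
  shows "L l = 0"
proof -
  have "L l = real l * L 1 \<and> L (Suc l) = real (Suc l) * L 1" for l
  proof (induction l)
    case (Suc l)
    then show ?case using harmonic[of l] by (simp add: field_simps)
  qed (simp add: assms(1))
  then have linear: "L l = real l * L 1" for l by blast
  have "L 1 = 0"
  proof (rule ccontr)
    assume "L 1 \<noteq> 0"
    then have "L 1 > 0" using bounds(1)[of 1] by simp
    then obtain n :: nat where "real n * L 1 > B" using ex_less_of_nat_mult by blast
    then show False using linear[of n] bounds(2)[of n] by simp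
  qed
  then show ?thesis using linear[of l] by simp
qed

lemma chain_count_ratio_tendsto_0: "(\<lambda>k. real (chain_count k l) / 2 ^ k) \<longlonglongrightarrow> 0"
proof -
  define p where "p l k = real (chain_count k l) / 2 ^ k" for l k
  have p_le: "p l k \<le> 1" for l k
    using of_nat_mono[OF chain_count_le[of k l], where 'a = real] by (simp add: p_def)
  have "decseq (p l)" for l
  proof (rule decseq_SucI)
    show "p l (Suc k) \<le> p l k" for k
      using of_nat_mono[OF chain_count_Suc_le[of k l], where 'a = real]
      by (simp add: p_def field_simps)
  qed
  then have "convergent (p l)" for l
    using p_le by (intro Bseq_monoseq_convergent BseqI'[of _ 1] decseq_imp_monoseq) (auto simp: p_def)
  then obtain L where limit_L: "\<And>l. p l \<longlonglongrightarrow> L l" unfolding convergent_def by metis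
  have "p 0 = (\<lambda>_. 0)" by (simp add: p_def chain_count_0_right fun_eq_iff)
  then have "L 0 = 0" using limit_L[of 0] by (simp add: LIMSEQ_const_iff)
  moreover have "2 * L (Suc l) = L (Suc (Suc l)) + L l" for l
  proof (rule LIMSEQ_unique)
    show "(\<lambda>k. 2 * p (Suc l) (Suc k)) \<longlonglongrightarrow> 2 * L (Suc l)"
      by (intro tendsto_intros LIMSEQ_Suc limit_L)
    have "2 * p (Suc l) (Suc k) = p (Suc (Suc l)) k + p l k" for k
      by (simp add: p_def add_divide_distrib)
    then show "(\<lambda>k. 2 * p (Suc l) (Suc k)) \<longlonglongrightarrow> L (Suc (Suc l)) + L l"
      by (simp only:) (intro tendsto_intros limit_L)
  qed
  moreover have "0 \<le> L l" "L l \<le> 1" for l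
    using LIMSEQ_le_const[OF limit_L] LIMSEQ_le_const2[OF limit_L] p_le by (auto simp: p_def)
  ultimately have "L l = 0" by (rule bounded_harmonic_eq_0)
  then show ?thesis using limit_L[of l] by (simp add: p_def[abs_def])
qed

section \<open>Counting Latin hypercubes\<close>

definition latin_hypercubes :: "'i set \<Rightarrow> (('i \<Rightarrow> klein) \<Rightarrow> klein) set" where
  "latin_hypercubes K = {f \<in> points K \<rightarrow>\<^sub>E UNIV. latin K f}"

lemma finite_latin_hypercubes:
  assumes "finite K" shows "finite (latin_hypercubes K)"
  unfolding latin_hypercubes_def
  using finite_PiE[OF finite_points[OF assms], of "\<lambda>_. UNIV :: klein set"]
  by (intro finite_subset[OF Collect_restrict]) simp

definition completions :: "'i set \<Rightarrow> (('i \<Rightarrow> klein) \<Rightarrow> klein) \<Rightarrow> (('i \<Rightarrow> klein) \<Rightarrow> klein) set" where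
  "completions S f = {g \<in> latin_hypercubes S. \<forall>x\<in>boundary S. g x = f x}"

lemma completions_cong:
  "(\<And>x. x \<in> boundary S \<Longrightarrow> f x = g x) \<Longrightarrow> completions S f = completions S g"
  by (auto simp: completions_def)

lemma finite_completions: "finite S \<Longrightarrow> finite (completions S f)"
  by (simp add: completions_def finite_latin_hypercubes)

lemma completions_eqI:
  assumes "g \<in> completions S f" "h \<in> completions S f" "\<And>x. x \<in> points S \<Longrightarrow> g x = h x"
  shows "g = h"
  using assms
  by (intro extensionalityI[of g "points S" h])
    (auto simp: completions_def latin_hypercubes_def PiE_def)

lemma latin_restrict_iff: "latin S (restrict f (points S)) \<longleftrightarrow> latin S f"
  by (simp add: latin_def points_upd inj_def)

lemma restrict_mem_completions:
  assumes "latin S g" "\<And>x. x \<in> boundary S \<Longrightarrow> g x = f x"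
  shows "restrict g (points S) \<in> completions S f"
  using assms boundary_subset[of S]
  by (auto simp: completions_def latin_hypercubes_def latin_restrict_iff)

lemma affine_on_cong: "(\<And>x. x \<in> X \<Longrightarrow> f x = g x) \<Longrightarrow> affine_on X S f \<longleftrightarrow> affine_on X S g"
  unfolding affine_on_def by simp

lemma affine_on_points_mono:
  assumes "affine_on (points S) S f" "T \<subseteq> S" "finite S"
  shows "affine_on (points T) T f"
proof -
  obtain u p where zero_bij_p: "zero_bij p" and f_eq: "\<And>x. x \<in> points S \<Longrightarrow> f x = u + sum (relabel p x) S"
    using assms(1) by (auto simp: affine_on_def)
  have "f x = u + sum (relabel p x) T" if "x \<in> points T" for x
  proof -
    have "sum (relabel p x) S = sum (relabel p x) T"
      using assms(2,3) that zero_bij_p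
      by (intro sum.mono_neutral_right) (auto simp: points_def relabel_def zero_bij_def)
    then show ?thesis using f_eq points_mono[OF assms(2)] that by auto
  qed
  with zero_bij_p show ?thesis by (auto simp: affine_on_def)
qed

lemma affine_on_points_unique:
  fixes f g :: "('i \<Rightarrow> klein) \<Rightarrow> klein"
  assumes S_props: "finite S" "card S \<ge> 2"
    and affine: "affine_on (points S) S f" "affine_on (points S) S g"
    and boundary_eq: "\<And>x. x \<in> boundary S \<Longrightarrow> f x = g x" and x_in: "x \<in> points S"
  shows "f x = g x"
proof -
  obtain u p where zero_bij_p: "zero_bij p" and f_eq: "\<And>x. x \<in> points S \<Longrightarrow> f x = u + sum (relabel p x) S"
    using affine(1) by (auto simp: affine_on_def)
  obtain v q where zero_bij_q: "zero_bij q" and g_eq: "\<And>x. x \<in> points S \<Longrightarrow> g x = v + sum (relabel q x) S"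
    using affine(2) by (auto simp: affine_on_def)
  have sum_axis: "sum (relabel p ((\<lambda>_. 0)(i := w))) S = p i w"
    if "i \<in> S" "zero_bij p" for i w and p :: "'i \<Rightarrow> klein \<Rightarrow> klein"
  proof -
    have "relabel p (\<lambda>_. 0) = (\<lambda>_. 0)" using that by (simp add: relabel_def zero_bij_def)
    then show ?thesis using that sum_upd[OF S_props(1) that(1), of "\<lambda>_. 0"] by (simp add: relabel_upd)
  qed
  have axis_boundary: "(\<lambda>_. 0)(i := w) \<in> boundary S" if "i \<in> S" for i w
  proof -
    obtain j where "j \<in> S" "j \<noteq> i"
      using S_props by (metis One_nat_def Suc_1 card_le_Suc0_iff_eq not_less_eq_eq)
    then show ?thesis using that by (auto simp: boundary_def points_def)
  qed
  have axis_eq: "u + p i w = v + q i w" if "i \<in> S" for i w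
  proof -
    have "(\<lambda>_. 0)(i := w) \<in> points S" using axis_boundary[OF that] boundary_subset by blast
    then show ?thesis
      using boundary_eq[OF axis_boundary[OF that]] f_eq g_eq sum_axis[OF that zero_bij_p]
        sum_axis[OF that zero_bij_q] by metis
  qed
  obtain i where "i \<in> S" using S_props(2) by fastforce
  then have consts_eq: "u = v" using axis_eq[of i 0] zero_bij_p zero_bij_q by (simp add: zero_bij_def)
  then have "sum (relabel p x) S = sum (relabel q x) S"
    using axis_eq by (intro sum.cong) (auto simp: relabel_def)
  then show ?thesis using f_eq[OF x_in] g_eq[OF x_in] consts_eq by simp
qed

lemma affine_completion_unique:
  assumes "finite S" "card S \<ge> 2" "g \<in> completions S f" "h \<in> completions S f"
    and "affine_on (points S) S g" "affine_on (points S) S h"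
  shows "g = h"
  using assms(3,4)
proof (rule completions_eqI)
  show "g x = h x" if "x \<in> points S" for x
    using assms(1,2,5,6)
    by (rule affine_on_points_unique) (use assms(3,4) that in \<open>auto simp: completions_def\<close>)
qed

lemma latin_eq_affine_plus_flip:
  assumes S_props: "finite S" "card S \<ge> 2" and latin_g: "latin S g" and zero_bij_p: "zero_bij p"
    and boundary_eq: "\<And>x. x \<in> boundary S \<Longrightarrow> g x = u + sum (relabel p x) S"
  shows "\<exists>e. \<forall>x\<in>points S. g x = u + sum (relabel p x) S + flip S e (relabel p x)"
proof -
  let ?q = "\<lambda>i. inv (p i)"
  have zero_bij_q: "zero_bij ?q" using zero_bij_p by (rule zero_bij_inv)
  interpret latin_sum_boundary S "\<lambda>x. u + g (relabel ?q x)"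
  proof
    show "u + g (relabel ?q x) = sum x S" if "x \<in> boundary S" for x
      using boundary_eq[of "relabel ?q x"] that zero_bij_p zero_bij_q
      by (simp add: relabel_mem_boundary_iff)
  qed (use S_props latin_relabel[OF latin_g zero_bij_q] in auto)
  obtain e where flip_e: "\<And>x. x \<in> points S \<Longrightarrow> \<delta> x = flip S e x" using ex_deviation_eq_flip by blast
  have "g x = u + sum (relabel p x) S + flip S e (relabel p x)" if "x \<in> points S" for x
    using flip_e[of "relabel p x"] that zero_bij_p
    by (simp add: relabel_mem_points_iff deviation_def klein_add_eq_iff ac_simps)
  then show ?thesis by blast
qed

lemma card_completions_le_4:
  assumes S_props: "finite S" "card S \<ge> 2"
    and affine_g: "g \<in> completions S f" "affine_on (points S) S g"
  shows "card (completions S f) \<le> 4"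
proof -
  obtain u p where zero_bij_p: "zero_bij p" and g_eq: "\<And>x. x \<in> points S \<Longrightarrow> g x = u + sum (relabel p x) S"
    using affine_g(2) by (auto simp: affine_on_def)
  let ?h = "\<lambda>e. restrict (\<lambda>x. u + sum (relabel p x) S + flip S e (relabel p x)) (points S)"
  have "completions S f \<subseteq> range ?h"
  proof
    fix k assume k_in: "k \<in> completions S f"
    have "k x = u + sum (relabel p x) S" if "x \<in> boundary S" for x
      using k_in affine_g(1) g_eq[of x] that boundary_subset by (fastforce simp: completions_def)
    then obtain e where "\<forall>x\<in>points S. k x = u + sum (relabel p x) S + flip S e (relabel p x)"
      using latin_eq_affine_plus_flip[OF S_props _ zero_bij_p, of k u] k_in
      by (auto simp: completions_def latin_hypercubes_def)
    then have "k = ?h e"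
      using k_in
      by (intro extensionalityI[of k "points S"])
        (auto simp: completions_def latin_hypercubes_def PiE_def)
    then show "k \<in> range ?h" by (rule range_eqI)
  qed
  then have "card (completions S f) \<le> card (range ?h)" by (intro card_mono) simp_all
  also have "\<dots> \<le> card (UNIV :: klein set)" by (intro card_image_le) simp
  finally show ?thesis by simp
qed

lemma card_completions_le_2:
  assumes S_props: "finite S" "card S \<ge> 2"
    and no_affine: "\<And>g. g \<in> completions S f \<Longrightarrow> \<not> affine_on (points S) S g"
  shows "card (completions S f) \<le> 2"
proof (rule ccontr)
  assume "\<not> card (completions S f) \<le> 2"
  then have "3 \<le> card (completions S f)" by simp
  then obtain C where "C \<subseteq> completions S f" "card C = 3" by (rule obtain_subset_with_card_n)
  then obtain g h k where ghk_in: "g \<in> completions S f" "h \<in> completions S f" "k \<in> completions S f"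
    and ghk_distinct: "g \<noteq> h" "g \<noteq> k" "h \<noteq> k" by (auto simp: card_3_iff)
  have "pairwise_differ_on (points S) g h k"
    using completions_eqI[OF ghk_in(1,2)] completions_eqI[OF ghk_in(1,3)]
      completions_eqI[OF ghk_in(2,3)] ghk_distinct
    unfolding pairwise_differ_on_def by blast
  then have "affine_on (boundary S) S g"
    using ghk_in
    by (intro three_completions_affine[OF S_props, of g h k])
      (auto simp: completions_def latin_hypercubes_def)
  then obtain u p where zero_bij_p: "zero_bij p" "\<And>x. x \<in> boundary S \<Longrightarrow> g x = u + sum (relabel p x) S"
    by (auto simp: affine_on_def)
  let ?a = "\<lambda>x. u + sum (relabel p x) S"
  have "restrict ?a (points S) \<in> completions S f"
    using latin_affine[OF S_props(1) zero_bij_p(1)] zero_bij_p(2) ghk_in(1)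
    by (intro restrict_mem_completions) (auto simp: completions_def)
  moreover have "affine_on (points S) S (restrict ?a (points S))"
    using zero_bij_p(1) by (auto simp: affine_on_def)
  ultimately show False using no_affine by blast
qed

definition completion_numbering ::
    "'i set \<Rightarrow> (('i \<Rightarrow> klein) \<Rightarrow> klein) set \<Rightarrow> ((('i \<Rightarrow> klein) \<Rightarrow> klein) \<Rightarrow> nat) \<Rightarrow> bool" where
  "completion_numbering S C e \<longleftrightarrow> inj_on e C \<and> e ` C \<subseteq> {..<4} \<and>
     (\<forall>g\<in>C. affine_on (points S) S g \<longrightarrow> e g = 0) \<and>
     ((\<forall>g\<in>C. \<not> affine_on (points S) S g) \<longrightarrow> e ` C \<subseteq> {..<2})"

lemma ex_inj_on_lessThan_card:
  assumes "finite C"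
  shows "\<exists>e. inj_on e C \<and> e ` C \<subseteq> {..<card C}"
  using ex_bij_betw_finite_nat[OF assms] by (auto simp: bij_betw_def atLeast0LessThan)

lemma ex_inj_on_lessThan_card_zero:
  assumes "finite C" "a \<in> C"
  shows "\<exists>e. inj_on e C \<and> e ` C \<subseteq> {..<card C} \<and> e a = 0"
proof -
  obtain e where e_numbering: "inj_on e (C - {a})" "e ` (C - {a}) \<subseteq> {..<card (C - {a})}"
    using ex_inj_on_lessThan_card[of "C - {a}"] assms(1) by auto
  let ?e = "\<lambda>g. if g = a then 0 else Suc (e g)"
  have "inj_on ?e C" using e_numbering(1) by (auto simp: inj_on_def)
  moreover have "?e ` C \<subseteq> {..<card C}"
  proof (intro image_subsetI)
    fix g assume g_in: "g \<in> C"
    have "card C = Suc (card (C - {a}))" using assms by (rule card.remove)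
    moreover have "e g < card (C - {a})" if "g \<noteq> a" using e_numbering(2) g_in that by blast
    ultimately show "?e g \<in> {..<card C}" by simp
  qed
  ultimately show ?thesis by (intro exI[of _ ?e]) simp
qed

lemma ex_completion_numbering:
  assumes S_props: "finite S" "card S \<ge> 2"
  shows "\<exists>e. completion_numbering S (completions S f) e"
proof (cases "\<exists>g\<in>completions S f. affine_on (points S) S g")
  case True
  then obtain g where affine_g: "g \<in> completions S f" "affine_on (points S) S g" by blast
  obtain e where e_numbering: "inj_on e (completions S f)"
    "e ` completions S f \<subseteq> {..<card (completions S f)}"
    "e g = 0" using ex_inj_on_lessThan_card_zero[OF finite_completions[OF S_props(1)] affine_g(1)]
      by blast
  have "e ` completions S f \<subseteq> {..<4}"
    using e_numbering(2) card_completions_le_4[OF S_props affine_g]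
    by (meson lessThan_subset_iff subset_trans)
  moreover have "e h = 0" if "h \<in> completions S f" "affine_on (points S) S h" for h
    using affine_completion_unique[OF S_props that(1) affine_g(1) that(2) affine_g(2)]
      e_numbering(3) by simp
  ultimately have "completion_numbering S (completions S f) e"
    using e_numbering(1) affine_g unfolding completion_numbering_def by blast
  then show ?thesis by blast
next
  case False
  obtain e where e_numbering: "inj_on e (completions S f)"
    "e ` completions S f \<subseteq> {..<card (completions S f)}"
    using ex_inj_on_lessThan_card[OF finite_completions[OF S_props(1)]] by blast
  have "card (completions S f) \<le> 2" using card_completions_le_2[OF S_props] False by blast
  then have "e ` completions S f \<subseteq> {..<2}" using e_numbering(2)
    by (meson lessThan_subset_iff subset_trans)
  moreover from this have "e ` completions S f \<subseteq> {..<4}" by auto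
  ultimately have "completion_numbering S (completions S f) e"
    using e_numbering(1) False by (simp add: completion_numbering_def)
  then show ?thesis by blast
qed

definition completion_index ::
    "'i set \<Rightarrow> (('i \<Rightarrow> klein) \<Rightarrow> klein) set \<Rightarrow> (('i \<Rightarrow> klein) \<Rightarrow> klein) \<Rightarrow> nat" where
  "completion_index S C = (SOME e. completion_numbering S C e)"

lemma completion_numbering_index:
  assumes "finite S" "card S \<ge> 2"
  shows "completion_numbering S (completions S f) (completion_index S (completions S f))"
  unfolding completion_index_def using ex_completion_numbering[OF assms] by (rule someI_ex)

text \<open>The completions are not counted on sets with at most one element: there the values are recorded
  separately.\<close>

definition index_family :: "(('i \<Rightarrow> klein) \<Rightarrow> klein) \<Rightarrow> 'i set \<Rightarrow> nat" where
  "index_family f S =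
     (if card S < 2 then 0 else completion_index S (completions S f) (restrict f (points S)))"

lemma index_family_eq_0_if_affine:
  assumes "finite S" "latin S f" "affine_on (points S) S f"
  shows "index_family f S = 0"
proof (cases "card S < 2")
  case False
  have "affine_on (points S) S (restrict f (points S))"
    using affine_on_cong[of "points S" "restrict f (points S)" f S] assms(3) by simp
  moreover have "restrict f (points S) \<in> completions S f"
    using assms(2) by (intro restrict_mem_completions) simp_all
  ultimately show ?thesis
    using completion_numbering_index[OF assms(1), of f] False
    by (auto simp: completion_numbering_def index_family_def)
qed (simp add: index_family_def)

lemma index_family_less:
  assumes "finite S" "latin S f"
  shows "index_family f S < 4"
    and "(\<And>g. g \<in> completions S f \<Longrightarrow> \<not> affine_on (points S) S g) \<Longrightarrow> index_family f S < 2"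
proof -
  let ?C = "completions S f"
  have "index_family f S \<in> completion_index S ?C ` ?C" if "\<not> card S < 2"
    using restrict_mem_completions[OF assms(2)] that by (simp add: index_family_def)
  moreover have "completion_numbering S ?C (completion_index S ?C)" if "\<not> card S < 2"
    using completion_numbering_index[OF assms(1)] that by simp
  moreover have "index_family f S = 0" if "card S < 2" using that by (simp add: index_family_def)
  ultimately show "index_family f S < 4"
    and "(\<And>g. g \<in> ?C \<Longrightarrow> \<not> affine_on (points S) S g) \<Longrightarrow> index_family f S < 2"
    unfolding completion_numbering_def by (cases "card S < 2"; force)+
qed

lemma index_family_less_2_above_nonzero:
  assumes "finite S" "latin S f" "T \<subset> S" "index_family f T \<noteq> 0"
  shows "index_family f S < 2"
proof (rule index_family_less(2)[OF assms(1,2)])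
  fix g assume g_in: "g \<in> completions S f"
  have TS: "T \<subseteq> S" using assms(3) by blast
  then have on_T: "finite T" "latin T f" using assms(1,2) finite_subset latin_mono by blast+
  show "\<not> affine_on (points S) S g"
  proof
    assume "affine_on (points S) S g"
    then have "affine_on (points T) T g" using TS assms(1) by (rule affine_on_points_mono)
    moreover have "g x = f x" if "x \<in> points T" for x
    proof -
      have "x \<in> boundary S" using that assms(3) unfolding boundary_def points_def by blast
      with g_in show ?thesis by (simp add: completions_def)
    qed
    ultimately have "affine_on (points T) T f" using affine_on_cong[of "points T" g f T] by simp
    then show False using index_family_eq_0_if_affine[OF on_T] assms(4) by simp
  qed
qed

lemma index_family_mem_index_families:
  assumes "finite K" "latin K f"
  shows "restrict (index_family f) (Pow K) \<in> index_families (Pow K)"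
proof -
  have on_S: "finite S" "latin S f" if "S \<subseteq> K" for S
    using that assms finite_subset latin_mono by auto
  have "index_family f S < 4" if "S \<subseteq> K" for S
    using on_S[OF that] by (rule index_family_less(1))
  moreover have "index_family f S < 2" if "S \<subseteq> K" "T \<subset> S" "index_family f T \<noteq> 0" for S T
    using on_S[OF that(1)] that(2,3) by (rule index_family_less_2_above_nonzero)
  ultimately show ?thesis by (auto simp: index_families_def PiE_iff)
qed

definition axes :: "'i set \<Rightarrow> ('i \<Rightarrow> klein) set" where
  "axes K = insert (\<lambda>_. 0) ((\<lambda>(i, v). (\<lambda>_. 0)(i := v)) ` (K \<times> UNIV))"

lemma finite_axes: "finite K \<Longrightarrow> finite (axes K)"
  by (simp add: axes_def)

lemma card_axes_le:
  assumes "finite K"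
  shows "card (axes K) \<le> 4 * card K + 1"
proof -
  let ?A = "(\<lambda>(i, v). (\<lambda>_. 0)(i := v)) ` (K \<times> (UNIV :: klein set))"
  have "card (axes K) \<le> Suc (card ?A)" unfolding axes_def by (rule card_insert_le_m1) simp_all
  also have "card ?A \<le> card (K \<times> (UNIV :: klein set))" using assms by (intro card_image_le) simp
  finally show ?thesis by (simp add: card_cartesian_product)
qed

lemma points_subset_axes:
  fixes S :: "'i set"
  assumes "S \<subseteq> K" "finite S" "card S < 2"
  shows "points S \<subseteq> axes K"
proof
  fix x :: "'i \<Rightarrow> klein" assume x_in: "x \<in> points S"
  consider (empty) "S = {}" | (singleton) i where "S = {i}"
    using assms(2,3) by (metis One_nat_def card_eq_0_iff card_1_singletonE less_2_cases)
  then show "x \<in> axes K"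
  proof cases
    case empty
    then have "x = (\<lambda>_. 0)" using x_in by (auto simp: points_def)
    then show ?thesis by (simp add: axes_def)
  next
    case (singleton i)
    then have "x = (\<lambda>_. 0)(i := x i)" using x_in by (fastforce simp: points_def)
    then show ?thesis
      using assms(1) singleton unfolding axes_def
      by (intro insertI2 image_eqI[of _ _ "(i, x i)"]) auto
  qed
qed

lemma latin_eq_if_index_family_eq:
  assumes "finite K" "latin K f" "latin K g"
    and axes_eq: "\<And>x. x \<in> axes K \<Longrightarrow> f x = g x"
    and index_eq: "\<And>S. S \<subseteq> K \<Longrightarrow> index_family f S = index_family g S"
    and x_on_S: "S \<subseteq> K" "x \<in> points S"
  shows "f x = g x"
  using finite_subset[OF x_on_S(1) assms(1)] x_on_S
proof (induction S arbitrary: x rule: finite_psubset_induct)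
  case (psubset S)
  show ?case
  proof (cases "card S < 2")
    case True
    then show ?thesis using points_subset_axes[OF psubset.prems(1) psubset.hyps]
        psubset.prems(2) axes_eq by blast
  next
    case False
    have boundary_eq: "f x = g x" if x_in: "x \<in> boundary S" for x
    proof -
      obtain i where "i \<in> S" "x i = 0" "x \<in> points S" using x_in by (auto simp: boundary_def)
      then have "x \<in> points (S - {i})" "S - {i} \<subset> S" by (auto simp: points_def)
      then show ?thesis using psubset.IH psubset.prems(1) by blast
    qed
    let ?C = "completions S f"
    have completions_eq: "?C = completions S g" using boundary_eq by (rule completions_cong)
    have "inj_on (completion_index S ?C) ?C"
      using completion_numbering_index[OF psubset.hyps, of f] False
      by (simp add: completion_numbering_def)
    moreover have "completion_index S ?C (restrict f (points S)) =
        completion_index S ?C (restrict g (points S))"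
      using index_eq[OF psubset.prems(1)] False by (simp add: index_family_def completions_eq)
    moreover have "restrict f (points S) \<in> ?C" "restrict g (points S) \<in> ?C"
      using latin_mono[OF assms(2) psubset.prems(1)] latin_mono[OF assms(3) psubset.prems(1)]
        boundary_eq
      by (auto intro: restrict_mem_completions)
    ultimately have "restrict f (points S) = restrict g (points S)" by (rule inj_onD)
    then show ?thesis using psubset.prems(2) by (metis restrict_apply')
  qed
qed

theorem card_latin_hypercubes_le:
  assumes "finite K"
  shows "card (latin_hypercubes K) \<le>
    4 ^ (4 * card K + 1) * (2 ^ 2 ^ card K * 3 ^ chain_count (card K) 1)"
proof -
  let ?L = "latin_hypercubes K"
  let ?h = "\<lambda>f. (restrict f (axes K), restrict (index_family f) (Pow K))"
  let ?R = "(axes K \<rightarrow>\<^sub>E (UNIV :: klein set)) \<times> index_families (Pow K)"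
  have "card ?L \<le> card ?R"
  proof (rule card_inj_on_le)
    show "inj_on ?h ?L"
    proof (rule inj_onI)
      fix f g assume fg_in: "f \<in> ?L" "g \<in> ?L" and images_eq: "?h f = ?h g"
      have axes_eq: "f x = g x" if "x \<in> axes K" for x
        using images_eq that by (metis Pair_inject restrict_apply')
      have index_eq: "index_family f S = index_family g S" if "S \<subseteq> K" for S
        using images_eq that by (metis PowI Pair_inject restrict_apply')
      have "f x = g x" if "x \<in> points K" for x
        by (rule latin_eq_if_index_family_eq[OF assms _ _ axes_eq index_eq subset_refl that])
          (use fg_in in \<open>auto simp: latin_hypercubes_def\<close>)
      moreover have "f \<in> extensional (points K)" "g \<in> extensional (points K)"
        using fg_in by (auto simp: latin_hypercubes_def PiE_def)
      ultimately show "f = g" by (intro extensionalityI)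
    qed
    show "?h ` ?L \<subseteq> ?R"
      using index_family_mem_index_families[OF assms]
      by (intro image_subsetI SigmaI) (auto simp: latin_hypercubes_def)
    show "finite ?R"
      using assms by (intro finite_cartesian_product finite_PiE finite_axes finite_index_families) auto
  qed
  also have "\<dots> = 4 ^ card (axes K) * card (index_families (Pow K))"
    using assms by (simp add: card_cartesian_product card_PiE finite_axes)
  also have "\<dots> \<le> 4 ^ (4 * card K + 1) * (2 ^ 2 ^ card K * 3 ^ chain_count (card K) 1)"
    using card_axes_le[OF assms] card_index_families_Pow[OF assms]
    by (intro mult_mono power_increasing) auto
  finally show ?thesis .
qed

section \<open>Isomorphisms of Cartesian products\<close>

definition graph_isomorphism ::
    "('a \<Rightarrow> 'b) \<Rightarrow> 'a pair_pre_digraph \<Rightarrow> 'b pair_pre_digraph \<Rightarrow> bool" where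
  "graph_isomorphism f G H \<longleftrightarrow> bij_betw f (pverts G) (pverts H) \<and>
     (\<forall>u\<in>pverts G. \<forall>v\<in>pverts G. (f u, f v) \<in> parcs H \<longleftrightarrow> (u, v) \<in> parcs G)"

definition graph_isomorphic :: "'a pair_pre_digraph \<Rightarrow> 'b pair_pre_digraph \<Rightarrow> bool"
    (infix "\<simeq>" 50) where
  "G \<simeq> H \<longleftrightarrow> (\<exists>f. graph_isomorphism f G H)"

lemma graph_isomorphicI: "graph_isomorphism f G H \<Longrightarrow> G \<simeq> H"
  by (auto simp: graph_isomorphic_def)

lemma graph_isomorphic_refl: "G \<simeq> G"
  by (rule graph_isomorphicI[of id]) (simp add: graph_isomorphism_def)

lemma graph_isomorphic_sym:
  assumes "G \<simeq> H" shows "H \<simeq> G"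
proof -
  obtain f where bij_f: "bij_betw f (pverts G) (pverts H)"
    and arcs: "\<And>u v. u \<in> pverts G \<Longrightarrow> v \<in> pverts G \<Longrightarrow> (f u, f v) \<in> parcs H \<longleftrightarrow> (u, v) \<in> parcs G"
    using assms by (auto simp: graph_isomorphic_def graph_isomorphism_def)
  let ?g = "inv_into (pverts G) f"
  have g_inverse: "?g x \<in> pverts G" "f (?g x) = x" if "x \<in> pverts H" for x
    using that bij_f by (auto simp: bij_betw_def inv_into_into f_inv_into_f)
  have "(?g x, ?g y) \<in> parcs G \<longleftrightarrow> (x, y) \<in> parcs H" if "x \<in> pverts H" "y \<in> pverts H" for x y
    using arcs[of "?g x" "?g y"] g_inverse[OF that(1)] g_inverse[OF that(2)] by simp
  then have "graph_isomorphism ?g H G"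
    using bij_betw_inv_into[OF bij_f] by (simp add: graph_isomorphism_def)
  then show ?thesis by (rule graph_isomorphicI)
qed

lemma graph_isomorphic_trans [trans]:
  assumes "G \<simeq> H" "H \<simeq> K" shows "G \<simeq> K"
proof -
  obtain f g where iso_f: "graph_isomorphism f G H" and iso_g: "graph_isomorphism g H K"
    using assms by (auto simp: graph_isomorphic_def)
  then have "bij_betw (g \<circ> f) (pverts G) (pverts K)"
    by (auto simp: graph_isomorphism_def intro: bij_betw_trans)
  moreover have "f u \<in> pverts H" if "u \<in> pverts G" for u
    using iso_f that by (auto simp: graph_isomorphism_def bij_betw_def)
  ultimately have "graph_isomorphism (g \<circ> f) G K"
    using iso_f iso_g by (simp add: graph_isomorphism_def)
  then show ?thesis by (rule graph_isomorphicI)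
qed

lemma pverts_cart_prod [simp]: "pverts (cart_prod G H) = pverts G \<times> pverts H"
  by (simp add: cart_prod_def)

lemma parcs_cart_prod_iff:
  "((a, b), (a', b')) \<in> parcs (cart_prod G H) \<longleftrightarrow>
     (a, a') \<in> parcs G \<and> b = b' \<and> b \<in> pverts H \<or> a = a' \<and> a \<in> pverts G \<and> (b, b') \<in> parcs H"
  by (simp add: cart_prod_def)

lemma cart_prod_cong:
  assumes "G \<simeq> G'" "H \<simeq> H'"
  shows "cart_prod G H \<simeq> cart_prod G' H'"
proof -
  obtain f g where iso_f: "graph_isomorphism f G G'" and iso_g: "graph_isomorphism g H H'"
    using assms by (auto simp: graph_isomorphic_def)
  then have bij_f: "bij_betw f (pverts G) (pverts G')" "bij_betw g (pverts H) (pverts H')"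
    by (auto simp: graph_isomorphism_def)
  have "graph_isomorphism (map_prod f g) (cart_prod G H) (cart_prod G' H')"
    unfolding graph_isomorphism_def
  proof (intro conjI ballI)
    show "bij_betw (map_prod f g) (pverts (cart_prod G H)) (pverts (cart_prod G' H'))"
      using bij_betw_map_prod[OF bij_f] by simp
  next
    fix p q assume "p \<in> pverts (cart_prod G H)" "q \<in> pverts (cart_prod G H)"
    then obtain a b a' b' where pq_eq: "p = (a, b)" "q = (a', b')"
      and coords_in: "a \<in> pverts G" "a' \<in> pverts G" "b \<in> pverts H" "b' \<in> pverts H" by auto
    have "f a = f a' \<longleftrightarrow> a = a'" "g b = g b' \<longleftrightarrow> b = b'"
      using bij_f coords_in by (auto simp: bij_betw_def inj_on_eq_iff)
    moreover have "f a \<in> pverts G'" "g b \<in> pverts H'"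
      using bij_f coords_in by (auto simp: bij_betw_def)
    moreover have "(f a, f a') \<in> parcs G' \<longleftrightarrow> (a, a') \<in> parcs G"
        "(g b, g b') \<in> parcs H' \<longleftrightarrow> (b, b') \<in> parcs H"
      using iso_f iso_g coords_in by (simp_all add: graph_isomorphism_def)
    ultimately show "(map_prod f g p, map_prod f g q) \<in> parcs (cart_prod G' H') \<longleftrightarrow>
        (p, q) \<in> parcs (cart_prod G H)"
      using coords_in by (simp add: pq_eq parcs_cart_prod_iff)
  qed
  then show ?thesis by (rule graph_isomorphicI)
qed

lemma cart_prod_assoc: "cart_prod (cart_prod G H) K \<simeq> cart_prod G (cart_prod H K)"
proof (rule graph_isomorphicI)
  let ?f = "\<lambda>((a, b), c). (a, (b, c))"
  have "bij_betw ?f (pverts (cart_prod (cart_prod G H) K)) (pverts (cart_prod G (cart_prod H K)))"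
    by (rule bij_betw_byWitness[where f' = "\<lambda>(a, (b, c)). ((a, b), c)"]) auto
  then show "graph_isomorphism ?f (cart_prod (cart_prod G H) K) (cart_prod G (cart_prod H K))"
    by (auto simp: graph_isomorphism_def parcs_cart_prod_iff)
qed

lemma cart_prod_left_commute: "cart_prod G (cart_prod H K) \<simeq> cart_prod H (cart_prod G K)"
proof (rule graph_isomorphicI)
  let ?f = "\<lambda>(a, (b, c)). (b, (a, c))"
  have "bij_betw ?f (pverts (cart_prod G (cart_prod H K))) (pverts (cart_prod H (cart_prod G K)))"
    by (rule bij_betw_byWitness[where f' = "\<lambda>(b, (a, c)). (a, (b, c))"]) auto
  then show "graph_isomorphism ?f (cart_prod G (cart_prod H K)) (cart_prod H (cart_prod G K))"
    by (auto simp: graph_isomorphism_def parcs_cart_prod_iff)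
qed

lemma pverts_cart_power [simp]: "pverts (cart_power G k) = {..<k} \<rightarrow>\<^sub>E pverts G"
  by (simp add: cart_power_def)

lemma parcs_cart_power_iff:
  "(x, y) \<in> parcs (cart_power G k) \<longleftrightarrow> x \<in> {..<k} \<rightarrow>\<^sub>E pverts G \<and> y \<in> {..<k} \<rightarrow>\<^sub>E pverts G \<and>
     (\<exists>i<k. (x i, y i) \<in> parcs G \<and> (\<forall>j<k. j \<noteq> i \<longrightarrow> x j = y j))"
  by (simp add: cart_power_def)

lemma cart_prod_cart_power_0: "cart_prod (cart_power G 0) H \<simeq> H"
proof (rule graph_isomorphicI)
  have "bij_betw snd (pverts (cart_prod (cart_power G 0) H)) (pverts H)"
    by (rule bij_betw_byWitness[where f' = "\<lambda>b. (\<lambda>_. undefined, b)"]) auto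
  then show "graph_isomorphism snd (cart_prod (cart_power G 0) H) H"
    by (auto simp: graph_isomorphism_def parcs_cart_prod_iff parcs_cart_power_iff)
qed

lemma cart_power_Suc: "cart_prod G (cart_power G k) \<simeq> cart_power G (Suc k)"
proof (rule graph_isomorphicI)
  let ?V = "{..<k} \<rightarrow>\<^sub>E pverts G" and ?f = "\<lambda>(a, x). x(k := a)"
  have upd_in_power: "x(k := a) \<in> {..<Suc k} \<rightarrow>\<^sub>E pverts G" if "a \<in> pverts G" "x \<in> ?V" for a x
    using that by (auto simp: PiE_iff extensional_def less_Suc_eq)
  have "bij_betw ?f (pverts (cart_prod G (cart_power G k))) (pverts (cart_power G (Suc k)))"
  proof (rule bij_betw_byWitness[where f' = "\<lambda>z. (z k, restrict z {..<k})"])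
    have "restrict (x(k := a)) {..<k} = x" if "x \<in> ?V" for a x
      using that by (intro extensionalityI[of _ "{..<k}"]) (auto simp: PiE_iff)
    then show "\<forall>p\<in>pverts (cart_prod G (cart_power G k)). (\<lambda>z. (z k, restrict z {..<k})) (?f p) = p"
      by auto
    have "(restrict z {..<k})(k := z k) = z" if "z \<in> {..<Suc k} \<rightarrow>\<^sub>E pverts G" for z
      using PiE_arb[OF that] by (intro ext) (simp add: restrict_def less_Suc_eq)
    then show "\<forall>z\<in>pverts (cart_power G (Suc k)). ?f (z k, restrict z {..<k}) = z"
      by simp
    show "?f ` pverts (cart_prod G (cart_power G k)) \<subseteq> pverts (cart_power G (Suc k))"
      by (intro image_subsetI) (simp add: split_beta mem_Times_iff upd_in_power)
    show "(\<lambda>z. (z k, restrict z {..<k})) ` pverts (cart_power G (Suc k))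
        \<subseteq> pverts (cart_prod G (cart_power G k))"
      by (intro image_subsetI) (simp add: PiE_iff)
  qed
  moreover have "(x(k := a), y(k := b)) \<in> parcs (cart_power G (Suc k)) \<longleftrightarrow>
      ((a, x), (b, y)) \<in> parcs (cart_prod G (cart_power G k))"
    if "a \<in> pverts G" "b \<in> pverts G" "x \<in> ?V" "y \<in> ?V" for a b x y
  proof -
    let ?P = "\<lambda>i. ((x(k := a)) i, (y(k := b)) i) \<in> parcs G \<and>
      (\<forall>j<Suc k. j \<noteq> i \<longrightarrow> (x(k := a)) j = (y(k := b)) j)"
    have "?P k \<longleftrightarrow> (a, b) \<in> parcs G \<and> x = y"
      using PiE_ext[OF that(3,4)] by (auto simp: All_less_Suc)
    moreover have "?P i \<longleftrightarrow> a = b \<and> (x i, y i) \<in> parcs G \<and> (\<forall>j<k. j \<noteq> i \<longrightarrow> x j = y j)" if "i < k" for i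
      using that by (auto simp: All_less_Suc)
    ultimately have "(\<exists>i<Suc k. ?P i) \<longleftrightarrow> (a, b) \<in> parcs G \<and> x = y \<or>
        a = b \<and> (\<exists>i<k. (x i, y i) \<in> parcs G \<and> (\<forall>j<k. j \<noteq> i \<longrightarrow> x j = y j))"
      unfolding Ex_less_Suc by blast
    then show ?thesis
      using that upd_in_power by (simp add: parcs_cart_prod_iff parcs_cart_power_iff del: fun_upd_apply)
  qed
  ultimately show "graph_isomorphism ?f (cart_prod G (cart_power G k)) (cart_power G (Suc k))"
    by (simp add: graph_isomorphism_def del: fun_upd_apply)
qed

lemma doob_Suc_left: "cart_prod shrikhande (doob m n) \<simeq> doob (Suc m) n"
proof -
  have "cart_prod shrikhande (doob m n) \<simeq>
      cart_prod (cart_prod shrikhande (cart_power shrikhande m)) (cart_power K4 n)"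
    unfolding doob_def by (rule graph_isomorphic_sym[OF cart_prod_assoc])
  also have "\<dots> \<simeq> doob (Suc m) n"
    unfolding doob_def by (rule cart_prod_cong[OF cart_power_Suc graph_isomorphic_refl])
  finally show ?thesis .
qed

lemma doob_Suc_right: "cart_prod K4 (doob m n) \<simeq> doob m (Suc n)"
proof -
  have "cart_prod K4 (doob m n) \<simeq> cart_prod (cart_power shrikhande m) (cart_prod K4 (cart_power K4 n))"
    unfolding doob_def by (rule cart_prod_left_commute)
  also have "\<dots> \<simeq> doob m (Suc n)"
    unfolding doob_def by (rule cart_prod_cong[OF graph_isomorphic_refl cart_power_Suc])
  finally show ?thesis .
qed

lemma doob_Suc_Suc_right: "cart_prod (cart_prod K4 K4) (doob m n) \<simeq> doob m (n + 2)"
proof -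
  have "cart_prod (cart_prod K4 K4) (doob m n) \<simeq> cart_prod K4 (cart_prod K4 (doob m n))"
    by (rule cart_prod_assoc)
  also have "\<dots> \<simeq> cart_prod K4 (doob m (Suc n))"
    by (rule cart_prod_cong[OF graph_isomorphic_refl doob_Suc_right])
  also have "\<dots> \<simeq> doob m (n + 2)"
    using doob_Suc_right[of m "Suc n"] by simp
  finally show ?thesis .
qed

section \<open>MDS codes in products\<close>

definition mds_codes :: "nat \<Rightarrow> 'a pair_pre_digraph \<Rightarrow> 'a set set" where
  "mds_codes q G = {C. independent_set G C \<and> q * card C = card (pverts G)}"

definition independence_ratio_le :: "nat \<Rightarrow> 'a pair_pre_digraph \<Rightarrow> bool" where
  "independence_ratio_le q G \<longleftrightarrow> (\<forall>C. independent_set G C \<longrightarrow> q * card C \<le> card (pverts G))"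

lemma mds_codes_subset_Pow: "mds_codes q G \<subseteq> Pow (pverts G)"
  by (auto simp: mds_codes_def independent_set_def)

lemma mds_code_no_arc: "C \<in> mds_codes q G \<Longrightarrow> u \<in> C \<Longrightarrow> v \<in> C \<Longrightarrow> (u, v) \<notin> parcs G"
  by (simp add: mds_codes_def independent_set_def)

lemma finite_mds_codes: "finite (pverts G) \<Longrightarrow> finite (mds_codes q G)"
  using mds_codes_subset_Pow by (rule finite_subset) simp

lemma maximum_independent_set_iff_mds_code:
  assumes "q > 0" "independence_ratio_le q G" "mds_codes q G \<noteq> {}"
  shows "maximum_independent_set G S \<longleftrightarrow> S \<in> mds_codes q G"
proof -
  obtain C where C_independent: "independent_set G C" "q * card C = card (pverts G)"
    using assms(3) by (auto simp: mds_codes_def)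
  have "q * card T \<le> q * card C" if "independent_set G T" for T
    using assms(2) that C_independent(2) by (simp add: independence_ratio_le_def)
  then have card_le: "card T \<le> card C" if "independent_set G T" for T
    using assms(1) that by simp
  have "maximum_independent_set G S \<longleftrightarrow> independent_set G S \<and> card S = card C"
    using card_le C_independent(1) by (auto simp: maximum_independent_set_def intro: antisym)
  also have "\<dots> \<longleftrightarrow> S \<in> mds_codes q G"
    using assms(1) by (auto simp: mds_codes_def simp flip: C_independent(2))
  finally show ?thesis .
qed

lemma independent_set_image_isomorphism:
  assumes "graph_isomorphism f G H" "S \<subseteq> pverts G"
  shows "independent_set H (f ` S) \<longleftrightarrow> independent_set G S"
proof -
  have "f ` S \<subseteq> pverts H" using assms by (auto simp: graph_isomorphism_def bij_betw_def)
  moreover have "(f u, f v) \<in> parcs H \<longleftrightarrow> (u, v) \<in> parcs G" if "u \<in> S" "v \<in> S" for u v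
    using assms that by (auto simp: graph_isomorphism_def)
  ultimately show ?thesis using assms(2) by (simp add: independent_set_def)
qed

lemma card_mds_codes_cong:
  assumes "G \<simeq> H"
  shows "card (mds_codes q G) = card (mds_codes q H)"
proof -
  obtain f where iso_f: "graph_isomorphism f G H" using assms by (auto simp: graph_isomorphic_def)
  then have bij_f: "bij_betw f (pverts G) (pverts H)" by (simp add: graph_isomorphism_def)
  have image_in_codes_iff: "f ` C \<in> mds_codes q H \<longleftrightarrow> C \<in> mds_codes q G" if "C \<subseteq> pverts G" for C
  proof -
    have "card (f ` C) = card C" using bij_f that by (meson bij_betw_def card_image inj_on_subset)
    then show ?thesis
      using independent_set_image_isomorphism[OF iso_f that] bij_betw_same_card[OF bij_f]
      by (simp add: mds_codes_def)
  qed
  have bij_image: "bij_betw ((`) f) (Pow (pverts G)) (Pow (pverts H))" using bij_f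
    by (rule bij_betw_Pow)
  have "(`) f ` mds_codes q G = mds_codes q H"
  proof
    show "(`) f ` mds_codes q G \<subseteq> mds_codes q H"
      using image_in_codes_iff mds_codes_subset_Pow[of q G] by blast
    show "mds_codes q H \<subseteq> (`) f ` mds_codes q G"
    proof
      fix D assume D_code: "D \<in> mds_codes q H"
      then have "D \<in> (`) f ` Pow (pverts G)"
        unfolding bij_betw_imp_surj_on[OF bij_image] by (rule subsetD[OF mds_codes_subset_Pow])
      then obtain C where "C \<subseteq> pverts G" "D = f ` C" by auto
      with D_code image_in_codes_iff[of C] show "D \<in> (`) f ` mds_codes q G" by simp
    qed
  qed
  then have "bij_betw ((`) f) (mds_codes q G) (mds_codes q H)"
    using bij_betw_subset[OF bij_image mds_codes_subset_Pow] by blast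
  then show ?thesis by (rule bij_betw_same_card)
qed

lemma independence_ratio_le_cong:
  assumes "G \<simeq> H" "independence_ratio_le q H"
  shows "independence_ratio_le q G"
  unfolding independence_ratio_le_def
proof (intro allI impI)
  fix C assume C_independent: "independent_set G C"
  obtain f where iso_f: "graph_isomorphism f G H" using assms(1) by (auto simp: graph_isomorphic_def)
  then have bij_f: "bij_betw f (pverts G) (pverts H)" by (simp add: graph_isomorphism_def)
  have C_subset: "C \<subseteq> pverts G" using C_independent by (simp add: independent_set_def)
  then have "card (f ` C) = card C" using bij_f by (meson bij_betw_def card_image inj_on_subset)
  moreover have "independent_set H (f ` C)"
    using independent_set_image_isomorphism[OF iso_f C_subset] C_independent by simp
  ultimately show "q * card C \<le> card (pverts G)"
    using assms(2) bij_betw_same_card[OF bij_f] by (metis independence_ratio_le_def)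
qed

definition fibre :: "('a \<times> 'b) set \<Rightarrow> 'b \<Rightarrow> 'a set" where
  "fibre C b = {a. (a, b) \<in> C}"

lemma mem_fibre_iff [simp]: "a \<in> fibre C b \<longleftrightarrow> (a, b) \<in> C"
  by (simp add: fibre_def)

lemma card_eq_sum_card_fibre:
  assumes "finite A" "finite B" "C \<subseteq> A \<times> B"
  shows "card C = (\<Sum>b\<in>B. card (fibre C b))"
proof -
  have "bij_betw prod.swap C (SIGMA b:B. fibre C b)"
    by (rule bij_betw_byWitness[where f' = prod.swap]) (use assms(3) in auto)
  then have "card C = card (SIGMA b:B. fibre C b)" by (rule bij_betw_same_card)
  moreover have "finite (fibre C b)" for b
    by (rule finite_subset[OF _ assms(1)]) (use assms(3) in auto)
  ultimately show ?thesis using assms(2) by (simp add: card_SigmaI)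
qed

lemma independent_set_fibre:
  assumes "independent_set (cart_prod G H) C"
  shows "independent_set G (fibre C b)"
  using assms by (fastforce simp: independent_set_def parcs_cart_prod_iff)

lemma mult_card_eq_sum_fibre:
  assumes "finite (pverts G)" "finite (pverts H)" "independent_set (cart_prod G H) C"
  shows "q * card C = (\<Sum>b\<in>pverts H. q * card (fibre C b))"
  using card_eq_sum_card_fibre[OF assms(1,2)] assms(3)
  by (simp add: independent_set_def sum_distrib_left)

lemma independence_ratio_le_cart_prod:
  assumes "finite (pverts G)" "finite (pverts H)" "independence_ratio_le q G"
  shows "independence_ratio_le q (cart_prod G H)"
  unfolding independence_ratio_le_def
proof (intro allI impI)
  fix C assume C_independent: "independent_set (cart_prod G H) C"
  have "q * card C = (\<Sum>b\<in>pverts H. q * card (fibre C b))"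
    using assms(1,2) C_independent by (rule mult_card_eq_sum_fibre)
  also have "\<dots> \<le> (\<Sum>b\<in>pverts H. card (pverts G))"
    using assms(3) independent_set_fibre[OF C_independent]
    by (intro sum_mono) (simp add: independence_ratio_le_def)
  finally show "q * card C \<le> card (pverts (cart_prod G H))"
    by (simp add: card_cartesian_product mult.commute)
qed

lemma fibre_mem_mds_codes:
  assumes "finite (pverts G)" "finite (pverts H)" "independence_ratio_le q G"
    and C_code: "C \<in> mds_codes q (cart_prod G H)" and b_in: "b \<in> pverts H"
  shows "fibre C b \<in> mds_codes q G"
proof -
  have independent: "independent_set (cart_prod G H) C" using C_code by (simp add: mds_codes_def)
  have "(\<Sum>b\<in>pverts H. q * card (fibre C b)) = (\<Sum>b\<in>pverts H. card (pverts G))"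
    using C_code mult_card_eq_sum_fibre[OF assms(1,2) independent, of q]
    by (simp add: mds_codes_def card_cartesian_product mult.commute)
  moreover have "q * card (fibre C b) \<le> card (pverts G)" for b
    using assms(3) independent_set_fibre[OF independent] by (simp add: independence_ratio_le_def)
  ultimately have "q * card (fibre C b) = card (pverts G)"
    using b_in assms(2) by (rule sum_mono_inv)
  then show ?thesis using independent_set_fibre[OF independent] by (simp add: mds_codes_def)
qed

lemma fibres_disjoint_if_arc:
  assumes C_code: "C \<in> mds_codes q (cart_prod G H)" and arc: "(b, b') \<in> parcs H"
  shows "fibre C b \<inter> fibre C b' = {}"
proof (rule equals0I)
  fix a assume "a \<in> fibre C b \<inter> fibre C b'"
  then have a_in: "(a, b) \<in> C" "(a, b') \<in> C" by auto
  then have "a \<in> pverts G" using C_code mds_codes_subset_Pow[of q "cart_prod G H"] by auto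
  then show False using mds_code_no_arc[OF C_code a_in] arc by (simp add: parcs_cart_prod_iff)
qed

definition mds_embedding ::
    "nat \<Rightarrow> 'a pair_pre_digraph \<Rightarrow> 'b pair_pre_digraph \<Rightarrow> ('a set \<Rightarrow> 'b set) \<Rightarrow> bool" where
  "mds_embedding q G G' h \<longleftrightarrow> h ` mds_codes q G \<subseteq> mds_codes q G' \<and> inj_on h (mds_codes q G) \<and>
     (\<forall>F\<in>mds_codes q G. \<forall>F'\<in>mds_codes q G. F \<inter> F' = {} \<longrightarrow> h F \<inter> h F' = {})"

definition map_fibres :: "('a set \<Rightarrow> 'b set) \<Rightarrow> 'c set \<Rightarrow> ('a \<times> 'c) set \<Rightarrow> ('b \<times> 'c) set" where
  "map_fibres h B C = {(a, b). b \<in> B \<and> a \<in> h (fibre C b)}"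

lemma fibre_map_fibres: "b \<in> B \<Longrightarrow> fibre (map_fibres h B C) b = h (fibre C b)"
  by (auto simp: map_fibres_def)

lemma map_fibres_mem_mds_codes:
  assumes finite_verts: "finite (pverts G)" "finite (pverts G')" "finite (pverts H)"
    and ratio: "independence_ratio_le q G" and embedding_h: "mds_embedding q G G' h"
    and C_code: "C \<in> mds_codes q (cart_prod G H)"
  shows "map_fibres h (pverts H) C \<in> mds_codes q (cart_prod G' H)"
proof -
  let ?D = "map_fibres h (pverts H) C"
  have fib: "fibre C b \<in> mds_codes q G" if "b \<in> pverts H" for b
    using finite_verts(1,3) ratio C_code that by (rule fibre_mem_mds_codes)
  have h_fib: "h (fibre C b) \<in> mds_codes q G'" if "b \<in> pverts H" for b
    using embedding_h fib[OF that] by (auto simp: mds_embedding_def)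
  have D_subset: "?D \<subseteq> pverts G' \<times> pverts H"
    using h_fib mds_codes_subset_Pow[of q G'] by (auto simp: map_fibres_def)
  have no_arc: "(b, b') \<notin> parcs H"
    if "a \<in> h (fibre C b)" "a \<in> h (fibre C b')" "b \<in> pverts H" "b' \<in> pverts H" for a b b'
    using embedding_h fib[OF that(3)] fib[OF that(4)] that(1,2) fibres_disjoint_if_arc[OF C_code]
    unfolding mds_embedding_def by blast
  have "independent_set (cart_prod G' H) ?D"
    unfolding independent_set_def
  proof (intro conjI ballI)
    fix p p' assume "p \<in> ?D" "p' \<in> ?D"
    then obtain a b a' b' where p_eq: "p = (a, b)" "p' = (a', b')"
      "b \<in> pverts H" "a \<in> h (fibre C b)" "b' \<in> pverts H" "a' \<in> h (fibre C b')"
      by (auto simp: map_fibres_def)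
    moreover have "(a, a') \<notin> parcs G'" if "b = b'"
      using mds_code_no_arc[OF h_fib[OF p_eq(3)]] p_eq(4,6) that by simp
    ultimately show "(p, p') \<notin> parcs (cart_prod G' H)"
      using no_arc by (auto simp: parcs_cart_prod_iff)
  qed (use D_subset in simp)
  moreover from this have "q * card ?D = (\<Sum>b\<in>pverts H. q * card (fibre ?D b))"
    by (rule mult_card_eq_sum_fibre[OF finite_verts(2,3)])
  then have "q * card ?D = card (pverts (cart_prod G' H))"
    using h_fib by (simp add: fibre_map_fibres mds_codes_def card_cartesian_product mult.commute)
  ultimately show ?thesis by (simp add: mds_codes_def)
qed

lemma inj_on_map_fibres:
  assumes finite_verts: "finite (pverts G)" "finite (pverts H)" and ratio: "independence_ratio_le q G"
    and embedding_h: "mds_embedding q G G' h"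
  shows "inj_on (map_fibres h (pverts H)) (mds_codes q (cart_prod G H))"
proof (rule inj_onI)
  fix C D assume C_code: "C \<in> mds_codes q (cart_prod G H)" and D_code: "D \<in> mds_codes q (cart_prod G H)"
    and images_eq: "map_fibres h (pverts H) C = map_fibres h (pverts H) D"
  have "fibre C b = fibre D b" if b_in: "b \<in> pverts H" for b
  proof -
    have "h (fibre C b) = h (fibre D b)" using fibre_map_fibres[OF b_in] images_eq by metis
    then show ?thesis
      using embedding_h fibre_mem_mds_codes[OF finite_verts ratio C_code b_in]
        fibre_mem_mds_codes[OF finite_verts ratio D_code b_in]
      by (auto simp: mds_embedding_def inj_on_eq_iff)
  qed
  then have "(a, b) \<in> C \<longleftrightarrow> (a, b) \<in> D" if "b \<in> pverts H" for a b
    using that mem_fibre_iff by metis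
  moreover have "C \<subseteq> pverts G \<times> pverts H" "D \<subseteq> pverts G \<times> pverts H"
    using C_code D_code by (auto simp: mds_codes_def independent_set_def)
  ultimately show "C = D" by auto
qed

lemma card_mds_codes_cart_prod_le:
  assumes "finite (pverts G)" "finite (pverts G')" "finite (pverts H)"
    and "independence_ratio_le q G" "mds_embedding q G G' h"
  shows "card (mds_codes q (cart_prod G H)) \<le> card (mds_codes q (cart_prod G' H))"
proof (rule card_inj_on_le)
  show "inj_on (map_fibres h (pverts H)) (mds_codes q (cart_prod G H))"
    using assms(1,3-5) by (rule inj_on_map_fibres)
  show "map_fibres h (pverts H) ` mds_codes q (cart_prod G H) \<subseteq> mds_codes q (cart_prod G' H)"
    using map_fibres_mem_mds_codes[OF assms] by blast
  show "finite (mds_codes q (cart_prod G' H))"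
    using assms(2,3) by (intro finite_mds_codes) simp
qed

section \<open>Codes in a product with \<open>K\<^sub>4\<close>\<close>

definition proper_colourings :: "'a pair_pre_digraph \<Rightarrow> ('a \<Rightarrow> 'c) set" where
  "proper_colourings G = {f \<in> pverts G \<rightarrow>\<^sub>E UNIV.
     \<forall>u\<in>pverts G. \<forall>v\<in>pverts G. (u, v) \<in> parcs G \<longrightarrow> f u \<noteq> f v}"

lemma pverts_K4 [simp]: "pverts K4 = UNIV"
  by (simp add: K4_def)

lemma parcs_K4_iff [simp]: "(u, v) \<in> parcs K4 \<longleftrightarrow> u \<noteq> v"
  by (simp add: K4_def)

lemma independent_set_K4_iff: "independent_set K4 F \<longleftrightarrow> card F \<le> 1"
  by (auto simp: independent_set_def card_le_Suc0_iff_eq)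

lemma independence_ratio_le_K4: "independence_ratio_le 4 K4"
  by (simp add: independence_ratio_le_def independent_set_K4_iff)

lemma mds_codes_K4: "mds_codes 4 K4 = range (\<lambda>a. {a})"
  by (auto simp: mds_codes_def independent_set_K4_iff card_1_singleton_iff)

lemma card_mds_codes_K4_cart_prod_le:
  fixes G :: "'a pair_pre_digraph"
  assumes "finite (pverts G)"
  shows "card (mds_codes 4 (cart_prod K4 G)) \<le> card (proper_colourings G :: ('a \<Rightarrow> 4) set)"
proof (rule card_inj_on_le)
  let ?M = "mds_codes 4 (cart_prod K4 G)"
  define colouring where "colouring C = restrict (\<lambda>b. the_elem (fibre C b)) (pverts G)"
    for C :: "(4 \<times> _) set"
  have mem_code_iff: "(a, b) \<in> C \<longleftrightarrow> b \<in> pverts G \<and> a = colouring C b" if "C \<in> ?M" for C a b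
  proof (cases "b \<in> pverts G")
    case True
    have "fibre C b \<in> mds_codes 4 K4"
      using assms independence_ratio_le_K4 that True
      by (intro fibre_mem_mds_codes[where H = G]) simp_all
    then obtain a' where fibre_eq: "fibre C b = {a'}" by (auto simp: mds_codes_K4)
    have "(a, b) \<in> C \<longleftrightarrow> a \<in> fibre C b" by simp
    then show ?thesis using True by (simp add: fibre_eq colouring_def del: mem_fibre_iff)
  next
    case False
    then show ?thesis using that mds_codes_subset_Pow[of 4 "cart_prod K4 G"] by auto
  qed
  show "inj_on colouring ?M" by (rule inj_onI) (auto simp: mem_code_iff)
  show "colouring ` ?M \<subseteq> proper_colourings G"
  proof (intro image_subsetI)
    fix C assume C_code: "C \<in> ?M"
    have "colouring C u \<noteq> colouring C v"
      if "u \<in> pverts G" "v \<in> pverts G" "(u, v) \<in> parcs G" for u v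
      using mds_code_no_arc[OF C_code, of "(colouring C u, u)" "(colouring C v, v)"]
        mem_code_iff[OF C_code] that
      by (auto simp: parcs_cart_prod_iff)
    then show "colouring C \<in> proper_colourings G"
      by (simp add: proper_colourings_def colouring_def)
  qed
  show "finite (proper_colourings G :: ('a \<Rightarrow> 4) set)"
    using assms by (simp add: proper_colourings_def finite_PiE)
qed

section \<open>From Shrikhande factors to pairs of \<open>K\<^sub>4\<close> factors\<close>

fun independent_lists :: "('a \<Rightarrow> 'a \<Rightarrow> bool) \<Rightarrow> 'a list \<Rightarrow> 'a list list" where
  "independent_lists E [] = [[]]"
| "independent_lists E (v # vs) = (let yss = independent_lists E vs in
     yss @ map ((#) v) (filter (list_all (\<lambda>y. \<not> E v y)) yss))"

lemma independent_lists_complete: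
  assumes "F \<subseteq> set vs" "\<forall>u\<in>F. \<forall>v\<in>F. \<not> E u v"
  shows "\<exists>ys\<in>set (independent_lists E vs). distinct ys \<and> set ys = F"
  using assms
proof (induction vs arbitrary: F)
  case (Cons v vs)
  have "F - {v} \<subseteq> set vs" using Cons.prems(1) by auto
  then obtain ys where ys: "ys \<in> set (independent_lists E vs)" "distinct ys" "set ys = F - {v}"
    using Cons.IH[of "F - {v}"] Cons.prems(2) by blast
  show ?case
  proof (cases "v \<in> F")
    case True
    then have "list_all (\<lambda>y. \<not> E v y) ys" using ys(3) Cons.prems(2) by (simp add: list_all_iff)
    then have "v # ys \<in> set (independent_lists E (v # vs))" using ys(1) by (simp add: Let_def)
    moreover have "distinct (v # ys)" "set (v # ys) = F" using ys(2,3) True by auto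
    ultimately show ?thesis by blast
  next
    case False
    then show ?thesis using ys by (auto simp: Let_def)
  qed
qed simp

lemma pverts_shrikhande [simp]: "pverts shrikhande = UNIV"
  by (simp add: shrikhande_def)

lemma parcs_shrikhande_iff [code_unfold]:
  "(u, v) \<in> parcs shrikhande \<longleftrightarrow> u - v \<in> {(1, 0), - (1, 0), (0, 1), - (0, 1), (1, 1), - (1, 1)}"
  by (simp add: shrikhande_def)

definition shrikhande_independent_lists :: "(4 \<times> 4) list list" where
  "shrikhande_independent_lists =
     independent_lists (\<lambda>u v. (u, v) \<in> parcs shrikhande) enum_class.enum"

text \<open>The sixteen independent 4-sets of the Shrikhande graph, each paired with the graph of a
  permutation of \<open>\<int>\<^sub>4\<close> that is not a 3-cycle.\<close>

definition shrikhande_permutation_table :: "((4 \<times> 4) list \<times> (4 \<times> 4) list) list" where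
  "shrikhande_permutation_table = [
    ([(0, 0), (0, 2), (2, 0), (2, 2)],
     [(0, 0), (1, 1), (2, 2), (3, 3)]),
    ([(0, 0), (0, 2), (2, 1), (2, 3)],
     [(0, 0), (1, 1), (2, 3), (3, 2)]),
    ([(0, 0), (1, 2), (2, 0), (3, 2)],
     [(0, 0), (1, 3), (2, 2), (3, 1)]),
    ([(0, 0), (1, 3), (2, 2), (3, 1)],
     [(0, 0), (1, 2), (2, 1), (3, 3)]),
    ([(0, 1), (0, 3), (2, 0), (2, 2)],
     [(0, 1), (1, 0), (2, 2), (3, 3)]),
    ([(0, 1), (0, 3), (2, 1), (2, 3)],
     [(0, 1), (1, 0), (2, 3), (3, 2)]),
    ([(0, 1), (1, 0), (2, 3), (3, 2)],
     [(0, 1), (1, 3), (2, 0), (3, 2)]),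
    ([(0, 1), (1, 3), (2, 1), (3, 3)],
     [(0, 1), (1, 2), (2, 3), (3, 0)]),
    ([(0, 2), (1, 0), (2, 2), (3, 0)],
     [(0, 2), (1, 1), (2, 0), (3, 3)]),
    ([(0, 2), (1, 1), (2, 0), (3, 3)],
     [(0, 3), (1, 1), (2, 2), (3, 0)]),
    ([(0, 3), (1, 1), (2, 3), (3, 1)],
     [(0, 3), (1, 0), (2, 1), (3, 2)]),
    ([(0, 3), (1, 2), (2, 1), (3, 0)],
     [(0, 2), (1, 0), (2, 3), (3, 1)]),
    ([(1, 0), (1, 2), (3, 0), (3, 2)],
     [(0, 2), (1, 3), (2, 0), (3, 1)]),
    ([(1, 0), (1, 2), (3, 1), (3, 3)],
     [(0, 2), (1, 3), (2, 1), (3, 0)]),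
    ([(1, 1), (1, 3), (3, 0), (3, 2)],
     [(0, 3), (1, 2), (2, 0), (3, 1)]),
    ([(1, 1), (1, 3), (3, 1), (3, 3)],
     [(0, 3), (1, 2), (2, 1), (3, 0)])]"

lemma shrikhande_table_complete:
  "\<forall>ys\<in>set shrikhande_independent_lists. length ys \<le> 4 \<and>
     (length ys = 4 \<longrightarrow> ys \<in> fst ` set shrikhande_permutation_table)"
  by code_simp

lemma shrikhande_table_permutations:
  "\<forall>t\<in>set shrikhande_permutation_table. length (snd t) = 4 \<and> distinct (snd t) \<and>
     (\<forall>u\<in>set (snd t). \<forall>v\<in>set (snd t). u \<noteq> v \<longrightarrow> fst u \<noteq> fst v \<and> snd u \<noteq> snd v)"
  by code_simp

lemma shrikhande_table_pairs:
  "\<forall>t\<in>set shrikhande_permutation_table. \<forall>t'\<in>set shrikhande_permutation_table.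
     (set (snd t) = set (snd t') \<longrightarrow> fst t = fst t') \<and>
     (set (fst t) \<inter> set (fst t') = {} \<longrightarrow> set (snd t) \<inter> set (snd t') = {})"
  by code_simp

lemma obtain_independent_list:
  assumes "independent_set shrikhande F"
  obtains ys where "ys \<in> set shrikhande_independent_lists" "set ys = F" "length ys = card F"
proof -
  have "\<forall>u\<in>F. \<forall>v\<in>F. (u, v) \<notin> parcs shrikhande" using assms by (simp add: independent_set_def)
  then have "\<exists>ys\<in>set shrikhande_independent_lists. distinct ys \<and> set ys = F"
    unfolding shrikhande_independent_lists_def
    by (intro independent_lists_complete) (simp_all only: enum_UNIV subset_UNIV)
  then show ?thesis using that by (auto simp flip: distinct_card)
qed

lemma independence_ratio_le_shrikhande: "independence_ratio_le 4 shrikhande"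
  unfolding independence_ratio_le_def
proof (intro allI impI)
  fix F assume "independent_set shrikhande F"
  then obtain ys where "ys \<in> set shrikhande_independent_lists" "length ys = card F"
    by (rule obtain_independent_list)
  then have "card F \<le> 4" using shrikhande_table_complete by metis
  then show "4 * card F \<le> card (pverts shrikhande)" by simp
qed

lemma shrikhande_mds_code_in_table:
  assumes "F \<in> mds_codes 4 shrikhande"
  shows "\<exists>t\<in>set shrikhande_permutation_table. set (fst t) = F"
proof -
  have F_independent: "independent_set shrikhande F" "card F = 4" using assms
    by (auto simp: mds_codes_def)
  from F_independent(1) obtain ys
    where "ys \<in> set shrikhande_independent_lists" "set ys = F" "length ys = card F"
    by (rule obtain_independent_list)
  then show ?thesis using shrikhande_table_complete F_independent(2) by fastforce
qed

lemma ex_mds_embedding_shrikhande: "\<exists>h. mds_embedding 4 shrikhande (cart_prod K4 K4) h"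
proof -
  let ?M = "mds_codes 4 shrikhande" and ?T = "set shrikhande_permutation_table"
  obtain t where t_in_table: "\<forall>F\<in>?M. t F \<in> ?T \<and> set (fst (t F)) = F"
    using shrikhande_mds_code_in_table bchoice[of ?M "\<lambda>F t. t \<in> ?T \<and> set (fst t) = F"] by blast
  let ?h = "\<lambda>F. set (snd (t F))"
  have "?h F \<in> mds_codes 4 (cart_prod K4 K4)" if "F \<in> ?M" for F
  proof -
    have zs_distinct: "length (snd (t F)) = 4" "distinct (snd (t F))"
      and permutation: "\<forall>u\<in>?h F. \<forall>v\<in>?h F. u \<noteq> v \<longrightarrow> fst u \<noteq> fst v \<and> snd u \<noteq> snd v"
      using shrikhande_table_permutations t_in_table that by blast+
    have "(u, v) \<notin> parcs (cart_prod K4 K4)" if "u \<in> ?h F" "v \<in> ?h F" for u v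
      using permutation that by (cases u; cases v) (fastforce simp: parcs_cart_prod_iff)
    moreover have "card (?h F) = 4" using zs_distinct by (simp add: distinct_card)
    ultimately show ?thesis by (simp add: mds_codes_def independent_set_def)
  qed
  moreover have "F = F'" if "F \<in> ?M" "F' \<in> ?M" "?h F = ?h F'" for F F'
    using shrikhande_table_pairs t_in_table that by metis
  moreover have "?h F \<inter> ?h F' = {}" if "F \<in> ?M" "F' \<in> ?M" "F \<inter> F' = {}" for F F'
    using shrikhande_table_pairs t_in_table that by metis
  ultimately have "mds_embedding 4 shrikhande (cart_prod K4 K4) ?h"
    by (auto simp: mds_embedding_def inj_on_def)
  then show ?thesis by blast
qed

section \<open>MDS codes of Doob graphs\<close>

lemma finite_pverts_doob: "finite (pverts (doob m n))"
  using pair_graph_doob pair_graph_iff by blast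

lemma independence_ratio_le_doob:
  assumes "m + n > 0"
  shows "independence_ratio_le 4 (doob m n)"
proof (cases m)
  case (Suc m')
  have "independence_ratio_le 4 (cart_prod shrikhande (doob m' n))"
    by (intro independence_ratio_le_cart_prod independence_ratio_le_shrikhande finite_pverts_doob) simp
  then show ?thesis
    using independence_ratio_le_cong[OF graph_isomorphic_sym[OF doob_Suc_left]] Suc by blast
next
  case 0
  then obtain n' where n_Suc: "n = Suc n'" using assms by (cases n) auto
  have "independence_ratio_le 4 (cart_prod K4 (doob m n'))"
    by (intro independence_ratio_le_cart_prod independence_ratio_le_K4 finite_pverts_doob) simp
  then show ?thesis
    using independence_ratio_le_cong[OF graph_isomorphic_sym[OF doob_Suc_right]] n_Suc by blast
qed

lemma card_mds_codes_doob_Suc_le: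
  "card (mds_codes 4 (doob (Suc m) n)) \<le> card (mds_codes 4 (doob m (n + 2)))"
proof -
  obtain h where "mds_embedding 4 shrikhande (cart_prod K4 K4) h"
    using ex_mds_embedding_shrikhande by blast
  then have "card (mds_codes 4 (cart_prod shrikhande (doob m n))) \<le>
      card (mds_codes 4 (cart_prod (cart_prod K4 K4) (doob m n)))"
    by (intro card_mds_codes_cart_prod_le)
      (simp_all add: finite_pverts_doob independence_ratio_le_shrikhande)
  then show ?thesis
    using card_mds_codes_cong[OF doob_Suc_left] card_mds_codes_cong[OF doob_Suc_Suc_right] by metis
qed

lemma card_mds_codes_doob_le_hamming:
  "card (mds_codes 4 (doob m n)) \<le> card (mds_codes 4 (cart_power K4 (2 * m + n)))"
proof (induction m arbitrary: n)
  case 0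
  then show ?case
    using card_mds_codes_cong[OF cart_prod_cart_power_0[of shrikhande "cart_power K4 n"], of 4]
    by (simp add: doob_def)
next
  case (Suc m)
  have "card (mds_codes 4 (doob (Suc m) n)) \<le> card (mds_codes 4 (doob m (n + 2)))"
    by (rule card_mds_codes_doob_Suc_le)
  also have "\<dots> \<le> card (mds_codes 4 (cart_power K4 (2 * m + (n + 2))))" by (rule Suc.IH)
  finally show ?case by simp
qed

lemma card_mds_codes_hamming_le:
  "card (mds_codes 4 (cart_power K4 (Suc k))) \<le>
     card (proper_colourings (cart_power K4 k) :: ((nat \<Rightarrow> 4) \<Rightarrow> 4) set)"
  using card_mds_codes_K4_cart_prod_le[of "cart_power K4 k"]
    card_mds_codes_cong[OF cart_power_Suc[of K4 k], of 4]
  by (simp add: finite_PiE)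

section \<open>Semilinear codes\<close>

text \<open>A vertex carries two bits \<open>s\<close>, \<open>t\<close> and is represented by a vertex \<open>\<nu> v\<close> with \<open>t (\<nu> v) = 0\<close>.
  Changing \<open>t\<close> by an arbitrary function of \<open>\<nu> v\<close> preserves independence of \<open>s = t = 0\<close>.\<close>

definition parity_labelling ::
    "'a pair_pre_digraph \<Rightarrow> ('a \<Rightarrow> 2) \<Rightarrow> ('a \<Rightarrow> 2) \<Rightarrow> ('a \<Rightarrow> 'a) \<Rightarrow> bool" where
  "parity_labelling G s t \<nu> \<longleftrightarrow>
     (\<forall>u\<in>pverts G. \<forall>v\<in>pverts G. (u, v) \<in> parcs G \<longrightarrow> s u = s v \<longrightarrow> \<nu> u = \<nu> v \<and> t u \<noteq> t v) \<and>
     (\<forall>v\<in>pverts G. \<nu> v \<in> pverts G \<and> \<nu> (\<nu> v) = \<nu> v \<and> s (\<nu> v) = s v \<and> t (\<nu> v) = 0)"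

lemma parity_labelling_arc:
  assumes "parity_labelling G s t \<nu>" "u \<in> pverts G" "v \<in> pverts G" "(u, v) \<in> parcs G" "s u = s v"
  shows "\<nu> u = \<nu> v" "t u \<noteq> t v"
  using assms by (auto simp: parity_labelling_def)

lemma parity_labelling_representative:
  assumes "parity_labelling G s t \<nu>" "v \<in> pverts G"
  shows "\<nu> v \<in> pverts G" "\<nu> (\<nu> v) = \<nu> v" "s (\<nu> v) = s v" "t (\<nu> v) = 0"
  using assms by (auto simp: parity_labelling_def)

definition semilinear_code ::
    "'a pair_pre_digraph \<Rightarrow> ('a \<Rightarrow> 2) \<Rightarrow> ('a \<Rightarrow> 2) \<Rightarrow> ('a \<Rightarrow> 'a) \<Rightarrow> 'a set \<Rightarrow> 2 \<times> 2 \<Rightarrow> 'a set" where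
  "semilinear_code G s t \<nu> L p =
     {v \<in> pverts G. s v = fst p \<and> t v + of_bool (\<nu> v \<in> L) = snd p}"

definition representatives :: "'a pair_pre_digraph \<Rightarrow> ('a \<Rightarrow> 2) \<Rightarrow> ('a \<Rightarrow> 'a) \<Rightarrow> 2 \<Rightarrow> 'a set" where
  "representatives G s \<nu> c = {v \<in> pverts G. \<nu> v = v \<and> s v = c}"

lemma finite_representatives: "finite (pverts G) \<Longrightarrow> finite (representatives G s \<nu> c)"
  by (simp add: representatives_def)

lemma independent_set_semilinear_code:
  assumes "parity_labelling G s t \<nu>"
  shows "independent_set G (semilinear_code G s t \<nu> L p)"
  unfolding independent_set_def
proof (intro conjI ballI notI)
  show "semilinear_code G s t \<nu> L p \<subseteq> pverts G" by (auto simp: semilinear_code_def)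
  fix u v assume uv_in: "u \<in> semilinear_code G s t \<nu> L p" "v \<in> semilinear_code G s t \<nu> L p"
    and arc: "(u, v) \<in> parcs G"
  then have "s u = s v" "t u + of_bool (\<nu> u \<in> L) = t v + of_bool (\<nu> v \<in> L)"
    by (simp_all only: semilinear_code_def mem_Collect_eq)
  moreover from this have "\<nu> u = \<nu> v" "t u \<noteq> t v"
    using parity_labelling_arc[OF assms] uv_in arc by (auto simp: semilinear_code_def)
  ultimately show False by simp
qed

lemma semilinear_code_mem_mds_codes:
  assumes "finite (pverts G)" "independence_ratio_le 4 G" "parity_labelling G s t \<nu>"
  shows "semilinear_code G s t \<nu> L p \<in> mds_codes 4 G"
proof -
  let ?C = "semilinear_code G s t \<nu> L"
  have independent: "independent_set G (?C p)" for p
    using assms(3) by (rule independent_set_semilinear_code)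
  have "card (pverts G) = (\<Sum>p\<in>UNIV. card (?C p))"
    using sum.group[OF assms(1), of UNIV "\<lambda>v. (s v, t v + of_bool (\<nu> v \<in> L))" "\<lambda>_. 1 :: nat"]
    by (simp add: semilinear_code_def prod_eq_iff)
  then have "(\<Sum>p\<in>UNIV. 4 * card (?C p)) = (\<Sum>p\<in>(UNIV :: (2 \<times> 2) set). card (pverts G))"
    by (simp flip: sum_distrib_left)
  moreover have "4 * card (?C p) \<le> card (pverts G)" for p
    using assms(2) independent by (simp add: independence_ratio_le_def)
  ultimately have "4 * card (?C p) = card (pverts G)"
    using UNIV_I finite by (rule sum_mono_inv)
  then show ?thesis using independent by (simp add: mds_codes_def)
qed

lemma card_mds_codes_ge_representatives:
  assumes "finite (pverts G)" "independence_ratio_le 4 G" "parity_labelling G s t \<nu>"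
  shows "2 ^ card (representatives G s \<nu> 0) \<le> card (mds_codes 4 G)"
proof -
  let ?R = "representatives G s \<nu> 0" and ?C = "\<lambda>L. semilinear_code G s t \<nu> L (0, 0)"
  have "v \<in> ?C L \<longleftrightarrow> v \<notin> L" if "v \<in> ?R" for v L
    using assms(3) that by (auto simp: parity_labelling_def representatives_def semilinear_code_def)
  then have "L = ?R - ?C L" if "L \<subseteq> ?R" for L using that by blast
  then have "inj_on ?C (Pow ?R)" by (metis (no_types, lifting) PowD inj_onI)
  moreover have "?C ` Pow ?R \<subseteq> mds_codes 4 G"
    using semilinear_code_mem_mds_codes[OF assms] by blast
  ultimately have "card (Pow ?R) \<le> card (mds_codes 4 G)"
    using finite_mds_codes[OF assms(1)] by (rule card_inj_on_le)
  then show ?thesis using finite_representatives[OF assms(1)] by (simp add: card_Pow)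
qed

definition has_parity_labelling :: "'a pair_pre_digraph \<Rightarrow> nat \<Rightarrow> nat \<Rightarrow> bool" where
  "has_parity_labelling G a b \<longleftrightarrow> (\<exists>s t \<nu>. parity_labelling G s t \<nu> \<and>
     card (representatives G s \<nu> 0) = a \<and> card (representatives G s \<nu> 1) = b)"

lemma has_parity_labelling_cong:
  assumes "G \<simeq> H" "has_parity_labelling H a b"
  shows "has_parity_labelling G a b"
proof -
  obtain f where bij_f: "bij_betw f (pverts G) (pverts H)"
    and arcs: "\<And>u v. u \<in> pverts G \<Longrightarrow> v \<in> pverts G \<Longrightarrow> (f u, f v) \<in> parcs H \<longleftrightarrow> (u, v) \<in> parcs G"
    using assms(1) by (auto simp: graph_isomorphic_def graph_isomorphism_def)
  obtain s t \<nu> where labelling_H: "parity_labelling H s t \<nu>"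
    and card_H: "card (representatives H s \<nu> 0) = a" "card (representatives H s \<nu> 1) = b"
    using assms(2) by (auto simp: has_parity_labelling_def)
  let ?g = "inv_into (pverts G) f"
  have f_inverse: "f v \<in> pverts H" "?g (f v) = v" if "v \<in> pverts G" for v
    using bij_f that by (auto simp: bij_betw_def)
  have g_inverse: "?g w \<in> pverts G" "f (?g w) = w" if "w \<in> pverts H" for w
    using bij_f that by (auto simp: bij_betw_def inv_into_into f_inv_into_f)
  let ?\<nu> = "\<lambda>v. ?g (\<nu> (f v))"
  note \<nu> = parity_labelling_representative[OF labelling_H f_inverse(1)]
  have "parity_labelling G (s \<circ> f) (t \<circ> f) ?\<nu>"
    unfolding parity_labelling_def
  proof (intro conjI ballI impI)
    fix u v assume uv_in: "u \<in> pverts G" "v \<in> pverts G" "(u, v) \<in> parcs G" "(s \<circ> f) u = (s \<circ> f) v"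
    then show "?\<nu> u = ?\<nu> v" "(t \<circ> f) u \<noteq> (t \<circ> f) v"
      using parity_labelling_arc[OF labelling_H f_inverse(1)[OF uv_in(1)] f_inverse(1)[OF uv_in(2)]]
        arcs by simp_all
  qed (simp_all add: \<nu> g_inverse)
  moreover have "bij_betw f (representatives G (s \<circ> f) ?\<nu> c) (representatives H s \<nu> c)" for c
  proof (rule bij_betw_byWitness[where f' = ?g])
    show "f ` representatives G (s \<circ> f) ?\<nu> c \<subseteq> representatives H s \<nu> c"
    proof (intro image_subsetI)
      fix v assume "v \<in> representatives G (s \<circ> f) ?\<nu> c"
      then have v_in: "v \<in> pverts G" "?\<nu> v = v" "s (f v) = c" by (auto simp: representatives_def)
      then have "\<nu> (f v) = f v" using g_inverse(2)[OF \<nu>(1)] by metis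
      then show "f v \<in> representatives H s \<nu> c" using v_in f_inverse(1)
        by (simp add: representatives_def)
    qed
  qed (use f_inverse g_inverse in \<open>auto simp: representatives_def\<close>)
  then have "card (representatives G (s \<circ> f) ?\<nu> c) = card (representatives H s \<nu> c)" for c
    by (rule bij_betw_same_card)
  ultimately show ?thesis
    unfolding has_parity_labelling_def using card_H
    by (intro exI[of _ "s \<circ> f"] exI[of _ "t \<circ> f"] exI[of _ ?\<nu>]) simp
qed

lemma two_exhaust:
  obtains "x = 0" | "x = (1 :: 2)"
proof -
  have "\<forall>x :: 2. x = 0 \<or> x = 1" by code_simp
  then show ?thesis using that by blast
qed

lemma parity_labelling_cart_prod:
  assumes labelling_G: "parity_labelling G s t \<nu>" and labelling_H: "parity_labelling H s' t' \<nu>'"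
  shows "parity_labelling (cart_prod G H)
    (\<lambda>(u, v). s u + s' v) (\<lambda>(u, v). t u + t' v) (map_prod \<nu> \<nu>')"
  unfolding parity_labelling_def
proof (intro conjI ballI impI)
  fix p p' assume p_in: "p \<in> pverts (cart_prod G H)" "p' \<in> pverts (cart_prod G H)"
    and arc: "(p, p') \<in> parcs (cart_prod G H)"
    and s_eq: "(case p of (u, v) \<Rightarrow> s u + s' v) = (case p' of (u, v) \<Rightarrow> s u + s' v)"
  obtain u v u' v' where uv_eq: "p = (u, v)" "p' = (u', v')" by fastforce
  then consider (left) "(u, u') \<in> parcs G" "v = v'" | (right) "u = u'" "(v, v') \<in> parcs H"
    using arc by (auto simp: parcs_cart_prod_iff)
  then have "map_prod \<nu> \<nu>' p = map_prod \<nu> \<nu>' p' \<and> t u + t' v \<noteq> t u' + t' v'"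
  proof cases
    case left
    then show ?thesis using parity_labelling_arc[OF labelling_G, of u u'] p_in s_eq by (simp add: uv_eq)
  next
    case right
    then show ?thesis using parity_labelling_arc[OF labelling_H, of v v'] p_in s_eq by (simp add: uv_eq)
  qed
  then show "map_prod \<nu> \<nu>' p = map_prod \<nu> \<nu>' p'"
    "(case p of (u, v) \<Rightarrow> t u + t' v) \<noteq> (case p' of (u, v) \<Rightarrow> t u + t' v)" by (simp_all add: uv_eq)
next
  fix p assume "p \<in> pverts (cart_prod G H)"
  then obtain u v where p_eq: "p = (u, v)" and uv_in: "u \<in> pverts G" "v \<in> pverts H" by auto
  note \<nu> = parity_labelling_representative[OF labelling_G uv_in(1)]
    parity_labelling_representative[OF labelling_H uv_in(2)]
  show "map_prod \<nu> \<nu>' p \<in> pverts (cart_prod G H)" using \<nu> by (simp add: p_eq)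
  show "map_prod \<nu> \<nu>' (map_prod \<nu> \<nu>' p) = map_prod \<nu> \<nu>' p" using \<nu> by (simp add: p_eq)
  show "(case map_prod \<nu> \<nu>' p of (u, v) \<Rightarrow> s u + s' v) = (case p of (u, v) \<Rightarrow> s u + s' v)"
    using \<nu> by (simp add: p_eq)
  show "(case map_prod \<nu> \<nu>' p of (u, v) \<Rightarrow> t u + t' v) = 0" using \<nu> by (simp add: p_eq)
qed

lemma representatives_cart_prod:
  "representatives (cart_prod G H) (\<lambda>(u, v). s u + s' v) (map_prod \<nu> \<nu>') c =
     representatives G s \<nu> c \<times> representatives H s' \<nu>' 0 \<union>
     representatives G s \<nu> (c + 1) \<times> representatives H s' \<nu>' 1"
proof -
  have "\<forall>x y c :: 2. x + y = c \<longleftrightarrow> x = c \<and> y = 0 \<or> x = c + 1 \<and> y = 1" by code_simp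
  then have "x + y = c \<longleftrightarrow> x = c \<and> y = 0 \<or> x = c + 1 \<and> y = 1" for x y by blast
  then show ?thesis by (intro set_eqI) (auto simp: representatives_def)
qed

lemma has_parity_labelling_cart_prod:
  assumes finite_verts: "finite (pverts G)" "finite (pverts H)"
    and has_G: "has_parity_labelling G h h" and has_H: "has_parity_labelling H a b"
  shows "has_parity_labelling (cart_prod G H) (h * (a + b)) (h * (a + b))"
proof -
  obtain s t \<nu> where labelling_G: "parity_labelling G s t \<nu>"
    and card_G: "card (representatives G s \<nu> 0) = h" "card (representatives G s \<nu> 1) = h"
    using has_G by (auto simp: has_parity_labelling_def)
  obtain s' t' \<nu>' where labelling_H: "parity_labelling H s' t' \<nu>'"
    and card_H: "card (representatives H s' \<nu>' 0) = a" "card (representatives H s' \<nu>' 1) = b"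
    using has_H by (auto simp: has_parity_labelling_def)
  have "card (representatives (cart_prod G H) (\<lambda>(u, v). s u + s' v) (map_prod \<nu> \<nu>') c)
      = h * (a + b)" for c
  proof -
    have "card (representatives G s \<nu> c) = h" for c using card_G by (cases c rule: two_exhaust) auto
    moreover have "representatives H s' \<nu>' 0 \<inter> representatives H s' \<nu>' 1 = {}"
      by (auto simp: representatives_def)
    ultimately show ?thesis
      using finite_verts card_H unfolding representatives_cart_prod
      by (subst card_Un_disjoint)
        (auto simp: card_cartesian_product finite_representatives add_mult_distrib2)
  qed
  then show ?thesis
    unfolding has_parity_labelling_def using parity_labelling_cart_prod[OF labelling_G labelling_H]
    by blast
qed

lemma has_parity_labelling_K4: "has_parity_labelling K4 1 1"
proof -
  let ?s = "\<lambda>x :: 4. of_bool (x \<in> {2, 3}) :: 2" and ?t = "\<lambda>x :: 4. of_bool (x \<in> {1, 3}) :: 2"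
    and ?\<nu> = "\<lambda>x :: 4. if x \<in> {2, 3} then 2 else 0 :: 4"
  have "\<forall>u v. u \<noteq> v \<longrightarrow> ?s u = ?s v \<longrightarrow> ?\<nu> u = ?\<nu> v \<and> ?t u \<noteq> ?t v" by code_simp
  then have "parity_labelling K4 ?s ?t ?\<nu>" by (auto simp: parity_labelling_def)
  moreover have "representatives K4 ?s ?\<nu> 0 = {0}" "representatives K4 ?s ?\<nu> 1 = {2}"
    by (auto simp: representatives_def)
  ultimately show ?thesis unfolding has_parity_labelling_def by fastforce
qed

lemma has_parity_labelling_shrikhande: "has_parity_labelling shrikhande 2 2"
proof -
  let ?s = "\<lambda>v :: 4 \<times> 4. of_bool (fst v \<in> {1, 3}) :: 2"
    and ?t = "\<lambda>v :: 4 \<times> 4. of_bool (snd v \<in> {1, 3}) :: 2"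
    and ?\<nu> = "\<lambda>v :: 4 \<times> 4. (fst v, 0 :: 4)"
  have "\<forall>u v. (u, v) \<in> parcs shrikhande \<longrightarrow> ?s u = ?s v \<longrightarrow> ?\<nu> u = ?\<nu> v \<and> ?t u \<noteq> ?t v"
    by code_simp
  then have "parity_labelling shrikhande ?s ?t ?\<nu>" by (auto simp: parity_labelling_def)
  moreover have "\<forall>x :: 4. x = 0 \<or> x = 1 \<or> x = 2 \<or> x = 3" by code_simp
  then have "representatives shrikhande ?s ?\<nu> 0 = {(0, 0), (2, 0)}"
    "representatives shrikhande ?s ?\<nu> 1 = {(1, 0), (3, 0)}"
    by (auto simp: representatives_def)
  ultimately show ?thesis unfolding has_parity_labelling_def by fastforce
qed

lemma has_parity_labelling_doob_Suc_left:
  assumes "has_parity_labelling (doob m n) a b" "a + b = 2 ^ (2 * m + n)"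
  shows "has_parity_labelling (doob (Suc m) n) (2 ^ (2 * m + n + 1)) (2 ^ (2 * m + n + 1))"
proof -
  have "has_parity_labelling (cart_prod shrikhande (doob m n)) (2 * (a + b)) (2 * (a + b))"
    using has_parity_labelling_shrikhande assms(1)
    by (intro has_parity_labelling_cart_prod) (simp_all add: finite_pverts_doob)
  then show ?thesis
    using has_parity_labelling_cong[OF graph_isomorphic_sym[OF doob_Suc_left]] assms(2) by simp
qed

lemma has_parity_labelling_doob_Suc_right:
  assumes "has_parity_labelling (doob m n) a b" "a + b = 2 ^ (2 * m + n)"
  shows "has_parity_labelling (doob m (Suc n)) (2 ^ (2 * m + n)) (2 ^ (2 * m + n))"
proof -
  have "has_parity_labelling (cart_prod K4 (doob m n)) (1 * (a + b)) (1 * (a + b))"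
    using has_parity_labelling_K4 assms(1)
    by (intro has_parity_labelling_cart_prod) (simp_all add: finite_pverts_doob)
  then show ?thesis
    using has_parity_labelling_cong[OF graph_isomorphic_sym[OF doob_Suc_right]] assms(2) by simp
qed

lemma has_parity_labelling_doob_0_0: "has_parity_labelling (doob 0 0) 1 0"
proof -
  let ?v = "(\<lambda>_. undefined, \<lambda>_. undefined)"
  have "pverts (doob 0 0) = {?v}" by (simp add: doob_def)
  then have "parity_labelling (doob 0 0) (\<lambda>_. 0) (\<lambda>_. 0) (\<lambda>v. v)"
    and "representatives (doob 0 0) (\<lambda>_. 0) (\<lambda>v. v) 0 = {?v}"
    and "representatives (doob 0 0) (\<lambda>_. 0) (\<lambda>v. v) 1 = {}"
    using pair_graph_doob[of 0 0]
    by (auto simp: parity_labelling_def representatives_def pair_graph_iff irrefl_def)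
  then show ?thesis unfolding has_parity_labelling_def by fastforce
qed

lemma ex_parity_labelling_doob: "\<exists>a b. has_parity_labelling (doob m n) a b \<and> a + b = 2 ^ (2 * m + n)"
proof (induction m)
  case 0
  show ?case
  proof (induction n)
    case 0
    show ?case
      using has_parity_labelling_doob_0_0 by (intro exI[of _ 1] exI[of _ 0]) simp
  next
    case (Suc n)
    then obtain a b where "has_parity_labelling (doob 0 n) a b" "a + b = 2 ^ (2 * 0 + n)" by blast
    then have "has_parity_labelling (doob 0 (Suc n)) (2 ^ (2 * 0 + n)) (2 ^ (2 * 0 + n))"
      by (rule has_parity_labelling_doob_Suc_right)
    moreover have "(2 :: nat) ^ (2 * 0 + n) + 2 ^ (2 * 0 + n) = 2 ^ (2 * 0 + Suc n)" by simp
    ultimately show ?case by blast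
  qed
next
  case (Suc m)
  then obtain a b where "has_parity_labelling (doob m n) a b" "a + b = 2 ^ (2 * m + n)" by blast
  then have "has_parity_labelling (doob (Suc m) n) (2 ^ (2 * m + n + 1)) (2 ^ (2 * m + n + 1))"
    by (rule has_parity_labelling_doob_Suc_left)
  moreover have "(2 :: nat) ^ (2 * m + n + 1) + 2 ^ (2 * m + n + 1) = 2 ^ (2 * Suc m + n)" by simp
  ultimately show ?case by blast
qed

lemma has_parity_labelling_doob:
  assumes "m + n > 0"
  shows "has_parity_labelling (doob m n) (2 ^ (2 * m + n - 1)) (2 ^ (2 * m + n - 1))"
proof (cases m)
  case (Suc m')
  obtain a b where "has_parity_labelling (doob m' n) a b" "a + b = 2 ^ (2 * m' + n)"
    using ex_parity_labelling_doob by blast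
  then show ?thesis using has_parity_labelling_doob_Suc_left Suc by simp
next
  case 0
  then obtain n' where n_Suc: "n = Suc n'" using assms by (cases n) auto
  obtain a b where "has_parity_labelling (doob 0 n') a b" "a + b = 2 ^ (2 * 0 + n')"
    using ex_parity_labelling_doob by blast
  then show ?thesis using has_parity_labelling_doob_Suc_right 0 n_Suc by fastforce
qed

lemma card_mds_codes_doob_ge:
  assumes "m + n > 0"
  shows "2 ^ 2 ^ (2 * m + n - 1) \<le> card (mds_codes 4 (doob m n))"
proof -
  obtain s t \<nu> where "parity_labelling (doob m n) s t \<nu>"
    and "card (representatives (doob m n) s \<nu> 0) = 2 ^ (2 * m + n - 1)"
    using has_parity_labelling_doob[OF assms] by (auto simp: has_parity_labelling_def)
  then show ?thesis
    using card_mds_codes_ge_representatives[OF finite_pverts_doob independence_ratio_le_doob[OF assms]]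
    by metis
qed

lemma num_mds_eq_card_mds_codes:
  assumes "m + n > 0"
  shows "num_mds m n = card (mds_codes 4 (doob m n))"
proof -
  have "mds_codes 4 (doob m n) \<noteq> {}" using card_mds_codes_doob_ge[OF assms] by auto
  then have "maximum_independent_set (doob m n) S \<longleftrightarrow> S \<in> mds_codes 4 (doob m n)" for S
    by (intro maximum_independent_set_iff_mds_code independence_ratio_le_doob assms) simp
  then show ?thesis by (simp add: num_mds_def)
qed

section \<open>The number of MDS codes\<close>

definition hypercube_of_colouring ::
    "nat \<Rightarrow> (4 \<Rightarrow> klein) \<Rightarrow> ((nat \<Rightarrow> 4) \<Rightarrow> 4) \<Rightarrow> (nat \<Rightarrow> klein) \<Rightarrow> klein" where
  "hypercube_of_colouring k \<phi> f =
     restrict (\<lambda>x. \<phi> (f (restrict (\<lambda>i. inv \<phi> (x i)) {..<k}))) (points {..<k})"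

lemma hypercube_of_colouring_mem_latin_hypercubes:
  assumes bij_\<phi>: "bij \<phi>" and f_in: "f \<in> proper_colourings (cart_power K4 k)"
  shows "hypercube_of_colouring k \<phi> f \<in> latin_hypercubes {..<k}"
proof -
  let ?vertex = "\<lambda>x. restrict (\<lambda>i. inv \<phi> (x i)) {..<k}"
  have "inj (\<lambda>v. hypercube_of_colouring k \<phi> f (x(i := v)))"
    if x_in: "x \<in> points {..<k}" and i_in: "i < k" for x i
  proof (rule injI, rule ccontr)
    fix v w assume "hypercube_of_colouring k \<phi> f (x(i := v)) = hypercube_of_colouring k \<phi> f (x(i := w))"
    then have colours_eq: "f (?vertex (x(i := v))) = f (?vertex (x(i := w)))"
      using x_in i_in bij_\<phi>
      by (simp add: hypercube_of_colouring_def points_upd bij_is_inj inj_eq del: fun_upd_apply)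
    assume "v \<noteq> w"
    then have "inv \<phi> v \<noteq> inv \<phi> w" using bij_\<phi> by (metis bij_inv_eq_iff)
    then have "(?vertex (x(i := v)), ?vertex (x(i := w))) \<in> parcs (cart_power K4 k)"
      using i_in by (auto simp: parcs_cart_power_iff)
    then show False using f_in colours_eq by (simp add: proper_colourings_def parcs_cart_power_iff)
  qed
  then show ?thesis
    by (simp add: latin_hypercubes_def latin_def hypercube_of_colouring_def)
qed

lemma inj_on_hypercube_of_colouring:
  assumes bij_\<phi>: "bij \<phi>"
  shows "inj_on (hypercube_of_colouring k \<phi>) (proper_colourings (cart_power K4 k))"
proof (rule inj_onI)
  let ?V = "pverts (cart_power K4 k)"
  fix f g assume "f \<in> proper_colourings (cart_power K4 k)" "g \<in> proper_colourings (cart_power K4 k)"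
    and images_eq: "hypercube_of_colouring k \<phi> f = hypercube_of_colouring k \<phi> g"
  then have fg_in: "f \<in> ?V \<rightarrow>\<^sub>E UNIV" "g \<in> ?V \<rightarrow>\<^sub>E UNIV" by (simp_all add: proper_colourings_def)
  have "f v = g v" if v_in: "v \<in> ?V" for v
  proof -
    let ?x = "\<lambda>i. if i < k then \<phi> (v i) else 0"
    have "?x \<in> points {..<k}" by (simp add: points_def)
    moreover have "restrict (\<lambda>i. inv \<phi> (?x i)) {..<k} = v"
      using v_in bij_\<phi> by (intro extensionalityI[of _ "{..<k}"]) (simp_all add: PiE_iff bij_is_inj)
    ultimately show ?thesis
      using fun_cong[OF images_eq, of ?x] bij_\<phi>
      by (simp add: hypercube_of_colouring_def bij_is_inj inj_eq)
  qed
  with fg_in show "f = g" by (intro PiE_ext)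
qed

lemma card_proper_colourings_le_latin_hypercubes:
  "card (proper_colourings (cart_power K4 k) :: ((nat \<Rightarrow> 4) \<Rightarrow> 4) set) \<le> card (latin_hypercubes {..<k})"
proof -
  obtain \<phi> :: "4 \<Rightarrow> klein" where bij_\<phi>: "bij \<phi>"
    using finite_same_card_bij[of "UNIV :: 4 set" "UNIV :: klein set"] by auto
  show ?thesis
  proof (rule card_inj_on_le)
    show "inj_on (hypercube_of_colouring k \<phi>) (proper_colourings (cart_power K4 k))"
      using bij_\<phi> by (rule inj_on_hypercube_of_colouring)
    show "hypercube_of_colouring k \<phi> ` proper_colourings (cart_power K4 k) \<subseteq> latin_hypercubes {..<k}"
      using hypercube_of_colouring_mem_latin_hypercubes[OF bij_\<phi>] by blast
  qed (simp add: finite_latin_hypercubes)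
qed

lemma num_mds_ge:
  assumes "2 * m + n \<ge> 1"
  shows "2 ^ 2 ^ (2 * m + n - 1) \<le> num_mds m n"
  using assms card_mds_codes_doob_ge[of m n] num_mds_eq_card_mds_codes[of m n] by (cases m) auto

lemma num_mds_pos: "2 * m + n \<ge> 1 \<Longrightarrow> 0 < num_mds m n"
  using num_mds_ge[of m n] by (meson less_le_trans zero_less_numeral zero_less_power)

lemma num_mds_le:
  assumes "2 * m + n = Suc k"
  shows "num_mds m n \<le> 2 ^ (2 ^ k + (8 * k + 2) + 2 * chain_count k 1)"
proof -
  have "num_mds m n = card (mds_codes 4 (doob m n))"
    using assms by (intro num_mds_eq_card_mds_codes) linarith
  also have "\<dots> \<le> card (mds_codes 4 (cart_power K4 (Suc k)))"
    using card_mds_codes_doob_le_hamming[of m n] assms by simp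
  also have "\<dots> \<le> card (proper_colourings (cart_power K4 k) :: ((nat \<Rightarrow> 4) \<Rightarrow> 4) set)"
    by (rule card_mds_codes_hamming_le)
  also have "\<dots> \<le> card (latin_hypercubes {..<k})"
    by (rule card_proper_colourings_le_latin_hypercubes)
  also have "\<dots> \<le> 4 ^ (4 * k + 1) * (2 ^ 2 ^ k * 3 ^ chain_count k 1)"
    using card_latin_hypercubes_le[of "{..<k}"] by simp
  also have "\<dots> \<le> (2\<^sup>2) ^ (4 * k + 1) * (2 ^ 2 ^ k * (2\<^sup>2) ^ chain_count k 1)"
    by (intro mult_mono power_mono) simp_all
  also have "\<dots> = 2 ^ (2 ^ k + (8 * k + 2) + 2 * chain_count k 1)"
    by (simp only: power_add power_mult[symmetric]) simp
  finally show ?thesis .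
qed

definition excess :: "nat \<Rightarrow> real" where
  "excess k = (8 * real k + 2 + 2 * real (chain_count k 1)) / 2 ^ k"

lemma excess_tendsto_0: "excess \<longlonglongrightarrow> 0"
proof -
  have "(\<lambda>k. 8 * (real k / 2 ^ k) + 2 * (1 / 2) ^ k + 2 * (real (chain_count k 1) / 2 ^ k)) \<longlonglongrightarrow>
      8 * 0 + 2 * 0 + 2 * 0"
    using lim_n_over_pown[of "2 :: real"]
    by (intro tendsto_intros chain_count_ratio_tendsto_0 LIMSEQ_realpow_zero) simp_all
  then show ?thesis by (simp add: excess_def[abs_def] add_divide_distrib power_divide)
qed

lemma log_num_mds_bounds:
  assumes "2 * m + n = Suc k"
  shows "0 \<le> log 2 (num_mds m n) / 2 ^ k - 1" "log 2 (num_mds m n) / 2 ^ k - 1 \<le> excess k"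
proof -
  have "2 ^ 2 ^ k \<le> num_mds m n" using num_mds_ge[of m n] assms by simp
  then have "real (2 ^ k) \<le> log 2 (num_mds m n)" by (rule le_log2_of_power)
  then show "0 \<le> log 2 (num_mds m n) / 2 ^ k - 1" by (simp add: field_simps)
  have "log 2 (num_mds m n) \<le> real (2 ^ k + (8 * k + 2) + 2 * chain_count k 1)"
    using num_mds_le[OF assms] num_mds_pos[of m n] assms by (intro log2_of_power_le) simp_all
  then have "log 2 (num_mds m n) / 2 ^ k \<le> (2 ^ k + (8 * k + 2 + 2 * chain_count k 1)) / 2 ^ k"
    by (intro divide_right_mono) simp_all
  then show "log 2 (num_mds m n) / 2 ^ k - 1 \<le> excess k"
    by (simp add: excess_def add_divide_distrib)
qed

theorem theorem1:
  shows "\<exists>e :: nat \<times> nat \<Rightarrow> real.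
    e \<in> o[filtercomap (\<lambda>(m, n). 2 * m + n) at_top](\<lambda>_. 1) \<and>
    (\<forall>m n :: nat. 2 * m + n \<ge> 1 \<longrightarrow>
      real (num_mds m n) = 2 powr (2 ^ (2 * m + n - 1) * (1 + e (m, n))))"
proof (intro exI conjI allI impI)
  let ?dim = "\<lambda>(m, n). 2 * m + n :: nat"
  let ?F = "filtercomap ?dim at_top"
  define e :: "nat \<times> nat \<Rightarrow> real" where
    "e = (\<lambda>(m, n). log 2 (num_mds m n) / 2 ^ (2 * m + n - 1) - 1)"
  have bounds: "0 \<le> e p \<and> e p \<le> excess (?dim p - 1)" if "?dim p \<ge> 1" for p
    using that log_num_mds_bounds[of "fst p" "snd p" "?dim p - 1"] by (simp add: e_def split_beta)
  have dim_at_top: "filterlim ?dim at_top ?F" by (rule filterlim_filtercomap)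
  then have "\<forall>\<^sub>F p in ?F. ?dim p \<ge> 1" by (simp add: filterlim_at_top)
  then have "\<forall>\<^sub>F p in ?F. 0 \<le> e p" "\<forall>\<^sub>F p in ?F. e p \<le> excess (?dim p - 1)"
    using bounds by (auto elim: eventually_mono)
  moreover have "((\<lambda>p. excess (?dim p - 1)) \<longlongrightarrow> 0) ?F"
    using filterlim_compose[OF excess_tendsto_0
        filterlim_compose[OF filterlim_minus_const_nat_at_top dim_at_top]] .
  ultimately have "(e \<longlongrightarrow> 0) ?F" by (rule tendsto_sandwich[OF _ _ tendsto_const])
  then show "e \<in> o[?F](\<lambda>_. 1)" by (intro smalloI_tendsto) auto
  show "real (num_mds m n) = 2 powr (2 ^ (2 * m + n - 1) * (1 + e (m, n)))" if "2 * m + n \<ge> 1" for m n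
    using num_mds_pos[OF that] by (simp add: e_def)
qed

end
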